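(* Assume the setting in the context, that QEPmin is in the easy case, and let $v_*$ be the (unique) minimizer of CRQopt. Let $(\lambda_*,u_* )$ be the minimizer of LGopt, let $\theta_{\min}$ and $\theta_{\max}$ be the smallest and largest eigenvalues of $H$, and set $\kappa=\frac{\theta_{\max}-\lambda_*}{\theta_{\min}-\lambda_*}$ and $\Gamma_\kappa=\frac{\sqrt\kappa+1}{\sqrt\kappa-1}$. Then: (a) the sequence $\{h(v^{(k)})\}$ is nonincreasing; (b) for $k\le k_{\max}$, $0\le h(v^{(k)})-h(v_* )\le 16\gamma^2\|H-\lambda_* I\|_2\,[\Gamma_\kappa^k+\Gamma_\kappa^{-k}]^{-2}$, $\|v^{(k)}-v_*\|_2\le 4\gamma\sqrt\kappa\,[\Gamma_\kappa^k+\Gamma_\kappa^{-k}]^{-1}$, $|\mu^{(k)}-\lambda_*|\le 16\|H-\lambda_* I\|_2\,[\Gamma_\kappa^k+\Gamma_\kappa^{-k}]^{-2}+\frac{4}{\gamma}\|b_0\|_2\sqrt\kappa\,[\Gamma_\kappa^k+\Gamma_\kappa^{-k}]^{-1}$.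
   Context: Let $A\in\mathbb{R}^{n\times n}$ be symmetric, $C\in\mathbb{R}^{n\times m}$ ($m<n$) full column rank, $b\in\mathbb{R}^m$, $n_0=C(C^{\top}C)^{-1}b$ with $\|n_0\|<1$, $\gamma=\sqrt{1-\|n_0\|^2}$, $P=I-C(C^{\top}C)^{-1}C^{\top}$ (orthogonal projector onto $\mathcal N(C^{\top})$), $b_0=PAn_0\neq0$. Let $h(v)=v^{\top}Av$. CRQopt: minimize $h(v)$ subject to $v^{\top}v=1$, $C^{\top}v=b$. LGopt: minimize $\lambda$ over $(\lambda,u)$ with $(PAP-\lambda I)u=-b_0$, $\|u\|=\gamma$, $u\in\mathcal N(C^{\top})$. QEPmin: minimize $\lambda$ over $(\lambda,z)$ with $\lambda\in\mathbb{R}$, $0\ne z\in\mathcal N(C^{\top})$, $(PAP-\lambda I)^2z=\gamma^{-2}b_0b_0^{\top}z$. QEPmin is in the hard case if it has a minimizer $(\lambda_*,z_* )$ with $b_0^{\top}z_*=0$, and in the easy case otherwise. Let $S_1\in\mathbb{R}^{n\times(n-m)}$ have orthonormal columns spanning $\mathcal N(C^{\top})$ and $H=S_1^{\top}AS_1$. Lanczos process: with $M=PAP$, $q_0=0$, $\beta_1=\|b_0\|$, $q_1=b_0/\|b_0\|$, for $j=1,2,\dots$: $\alpha_j=q_j^{\top}Mq_j$, $\widehat q_{j+1}=Mq_j-\alpha_jq_j-\beta_jq_{j-1}$, $\beta_{j+1}=\|\widehat q_{j+1}\|$, and if $\beta_{j+1}>0$, $q_{j+1}=\widehat q_{j+1}/\beta_{j+1}$.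 $k_{\max}$ is the smallest $k$ with $\beta_{k+1}=0$. For $k\le k_{\max}$, $Q_k=[q_1,\dots,q_k]$ (orthonormal basis of the Krylov space $\mathcal K_k(PAP,b_0)=\operatorname{span}\{b_0,PAPb_0,\dots,(PAP)^{k-1}b_0\}$) and $T_k=Q_k^{\top}PAPQ_k$ is the symmetric tridiagonal matrix with diagonal $\alpha_1,\dots,\alpha_k$ and off-diagonal $\beta_2,\dots,\beta_k$. rLGopt: minimize $\lambda$ over $(\lambda,x)\in\mathbb{R}\times\mathbb{R}^k$ with $(T_k-\lambda I)x=-\|b_0\|e_1$, $\|x\|=\gamma$; $(\mu^{(k)},x^{(k)})$ denotes its minimizer and $v^{(k)}=n_0+Q_kx^{(k)}$. *)

theory Defs
  imports "HOL-Analysis.Analysis"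
begin

definition n0 :: "real^'m^'n \<Rightarrow> real^'m \<Rightarrow> real^'n" where
  "n0 C b = C *v (matrix_inv (transpose C ** C) *v b)"

definition gam :: "real^'m^'n \<Rightarrow> real^'m \<Rightarrow> real" where
  "gam C b = sqrt (1 - (norm (n0 C b))\<^sup>2)"

definition Pr :: "real^'m^'n \<Rightarrow> real^'n^'n" where
  "Pr C = mat 1 - C ** matrix_inv (transpose C ** C) ** transpose C"

definition b0 :: "real^'n^'n \<Rightarrow> real^'m^'n \<Rightarrow> real^'m \<Rightarrow> real^'n" where
  "b0 A C b = Pr C *v (A *v n0 C b)"

definition hq :: "real^'n^'n \<Rightarrow> real^'n \<Rightarrow> real" where
  "hq A v = v \<bullet> (A *v v)"

definition CRQ_feasible :: "real^'m^'n \<Rightarrow> real^'m \<Rightarrow> real^'n \<Rightarrow> bool" where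
  "CRQ_feasible C b v \<longleftrightarrow> v \<bullet> v = 1 \<and> transpose C *v v = b"

definition CRQ_minimizer :: "real^'n^'n \<Rightarrow> real^'m^'n \<Rightarrow> real^'m \<Rightarrow> real^'n \<Rightarrow> bool" where
  "CRQ_minimizer A C b v \<longleftrightarrow> CRQ_feasible C b v \<and>
     (\<forall>w. CRQ_feasible C b w \<longrightarrow> hq A v \<le> hq A w)"

definition LG_feasible :: "real^'n^'n \<Rightarrow> real^'m^'n \<Rightarrow> real^'m \<Rightarrow> real \<Rightarrow> real^'n \<Rightarrow> bool" where
  "LG_feasible A C b lam u \<longleftrightarrow>
     (Pr C ** A ** Pr C - mat lam) *v u = - b0 A C b \<and> norm u = gam C b \<and>
     transpose C *v u = 0"

definition LG_minimizer :: "real^'n^'n \<Rightarrow> real^'m^'n \<Rightarrow> real^'m \<Rightarrow> real \<Rightarrow> real^'n \<Rightarrow> bool" where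
  "LG_minimizer A C b lam u \<longleftrightarrow> LG_feasible A C b lam u \<and>
     (\<forall>lam' u'. LG_feasible A C b lam' u' \<longrightarrow> lam \<le> lam')"

definition QEP_feasible :: "real^'n^'n \<Rightarrow> real^'m^'n \<Rightarrow> real^'m \<Rightarrow> real \<Rightarrow> real^'n \<Rightarrow> bool" where
  "QEP_feasible A C b lam z \<longleftrightarrow> z \<noteq> 0 \<and> transpose C *v z = 0 \<and>
     (Pr C ** A ** Pr C - mat lam) *v ((Pr C ** A ** Pr C - mat lam) *v z)
       = (inverse ((gam C b)\<^sup>2) * (b0 A C b \<bullet> z)) *\<^sub>R b0 A C b"

definition QEP_minimizer :: "real^'n^'n \<Rightarrow> real^'m^'n \<Rightarrow> real^'m \<Rightarrow> real \<Rightarrow> real^'n \<Rightarrow> bool" where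
  "QEP_minimizer A C b lam z \<longleftrightarrow> QEP_feasible A C b lam z \<and>
     (\<forall>lam' z'. QEP_feasible A C b lam' z' \<longrightarrow> lam \<le> lam')"

definition QEP_hard_case :: "real^'n^'n \<Rightarrow> real^'m^'n \<Rightarrow> real^'m \<Rightarrow> bool" where
  "QEP_hard_case A C b \<longleftrightarrow> (\<exists>lam z. QEP_minimizer A C b lam z \<and> b0 A C b \<bullet> z = 0)"

definition QEP_easy_case :: "real^'n^'n \<Rightarrow> real^'m^'n \<Rightarrow> real^'m \<Rightarrow> bool" where
  "QEP_easy_case A C b \<longleftrightarrow> \<not> QEP_hard_case A C b"

definition is_eigenvalue :: "real^'k^'k \<Rightarrow> real \<Rightarrow> bool" where
  "is_eigenvalue H t \<longleftrightarrow> (\<exists>x. x \<noteq> 0 \<and> H *v x = t *\<^sub>R x)"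

text \<open>Lanczos process with M = PAP started at b0.
  lanc j = (q_j, q_{j+1}, beta_{j+1}) (1-based paper indexing, q_0 = 0).
  Once beta vanishes the process has stopped; later values are irrelevant.\<close>
primrec lanc :: "real^'n^'n \<Rightarrow> real^'n \<Rightarrow> nat \<Rightarrow> (real^'n) \<times> (real^'n) \<times> real" where
  "lanc M r 0 = (0, (1 / norm r) *\<^sub>R r, norm r)"
| "lanc M r (Suc j) =
     (let (qp, qc, bc) = lanc M r j;
          al = qc \<bullet> (M *v qc);
          w = M *v qc - al *\<^sub>R qc - bc *\<^sub>R qp;
          bt = norm w
      in (qc, if bt > 0 then (1 / bt) *\<^sub>R w else 0, bt))"

text \<open>q_j for j \<ge> 1\<close>
definition lq :: "real^'n^'n \<Rightarrow> real^'n \<Rightarrow> nat \<Rightarrow> real^'n" where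
  "lq M r j = fst (snd (lanc M r (j - 1)))"

text \<open>beta_j for j \<ge> 1\<close>
definition lbeta :: "real^'n^'n \<Rightarrow> real^'n \<Rightarrow> nat \<Rightarrow> real" where
  "lbeta M r j = snd (snd (lanc M r (j - 1)))"

text \<open>alpha_j for j \<ge> 1\<close>
definition lalpha :: "real^'n^'n \<Rightarrow> real^'n \<Rightarrow> nat \<Rightarrow> real" where
  "lalpha M r j = lq M r j \<bullet> (M *v lq M r j)"

definition kmax :: "real^'n^'n \<Rightarrow> real^'n \<Rightarrow> nat" where
  "kmax M r = (LEAST k. 1 \<le> k \<and> lbeta M r (k + 1) = 0)"

text \<open>T_k as a function of 0-based indices i, j < k: entry (i,j) is the paper's (i+1,j+1).\<close>
definition Tk :: "real^'n^'n \<Rightarrow> real^'n \<Rightarrow> nat \<Rightarrow> nat \<Rightarrow> nat \<Rightarrow> real" where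
  "Tk M r k i j =
     (if i < k \<and> j < k then
        (if i = j then lalpha M r (i + 1)
         else if j = i + 1 then lbeta M r (i + 2)
         else if i = j + 1 then lbeta M r (j + 2)
         else 0)
      else 0)"

text \<open>rLGopt: x in R^k represented as nat \<Rightarrow> real vanishing outside {..<k}.\<close>
definition rLG_feasible :: "real^'n^'n \<Rightarrow> real^'m^'n \<Rightarrow> real^'m \<Rightarrow> nat \<Rightarrow> real \<Rightarrow> (nat \<Rightarrow> real) \<Rightarrow> bool" where
  "rLG_feasible A C b k lam x \<longleftrightarrow>
     (let M = Pr C ** A ** Pr C; r = b0 A C b in
       (\<forall>i\<ge>k. x i = 0) \<and>
       (\<forall>i<k. (\<Sum>j<k. Tk M r k i j * x j) - lam * x i = - norm r * (if i = 0 then 1 else 0)) \<and>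
       sqrt (\<Sum>i<k. (x i)\<^sup>2) = gam C b)"

definition rLG_minimizer :: "real^'n^'n \<Rightarrow> real^'m^'n \<Rightarrow> real^'m \<Rightarrow> nat \<Rightarrow> real \<Rightarrow> (nat \<Rightarrow> real) \<Rightarrow> bool" where
  "rLG_minimizer A C b k lam x \<longleftrightarrow> rLG_feasible A C b k lam x \<and>
     (\<forall>lam' x'. rLG_feasible A C b k lam' x' \<longrightarrow> lam \<le> lam')"

definition vk :: "real^'n^'n \<Rightarrow> real^'m^'n \<Rightarrow> real^'m \<Rightarrow> nat \<Rightarrow> (nat \<Rightarrow> real) \<Rightarrow> real^'n" where
  "vk A C b k x = n0 C b + (\<Sum>j<k. x j *\<^sub>R lq (Pr C ** A ** Pr C) (b0 A C b) (j + 1))"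

end

theory Submission
  imports Defs
begin

text \<open>On the sphere of radius \<open>\<gamma>\<close> in a subspace \<open>V\<close>, the objective \<open>q(w) = w \<bullet> M w + 2 b\<^sub>0 \<bullet> w\<close> has a
  minimizer whose Lagrange multiplier lies below all Rayleigh quotients of \<open>M\<close> on \<open>V\<close>; hence the
  critical pair with smallest multiplier is itself a minimizer. With \<open>V\<close> the null space of \<open>C\<^sup>T\<close>
  this describes LGopt, with \<open>V\<close> the Krylov space it describes rLGopt, and since the Krylov spaces are nested,
  the values decrease. In the easy case \<open>\<lambda>\<^sub>* < \<theta>\<^sub>m\<^sub>i\<^sub>n\<close>, so \<open>F = M - \<lambda>\<^sub>*\<close> is positive definite,
  \<open>u\<^sub>*\<close> solves \<open>F u\<^sub>* = -b\<^sub>0\<close>, and \<open>q(w) - q(u\<^sub>*) = (w - u\<^sub>*) \<bullet> F (w - u\<^sub>*)\<close> on the sphere. A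
  Chebyshev polynomial in \<open>F\<close> gives a Krylov vector close to \<open>u\<^sub>*\<close>; rescaling it to norm \<open>\<gamma>\<close> at
  most doubles its error, and all three bounds follow from this test vector.\<close>

section \<open>Sign conditions in the limit at 0\<close>

lemma isCont_nonneg_limit:
  fixes P :: "real \<Rightarrow> real"
  assumes "isCont P 0" and P: "\<And>t. 0 < t \<Longrightarrow> 0 \<le> P t"
  shows "0 \<le> P 0"
proof -
  have "(P \<longlongrightarrow> P 0) (at_right 0)"
    using assms(1) by (simp add: isCont_def filterlim_at_split)
  moreover have "\<forall>\<^sub>F t in at_right 0. 0 \<le> P t"
    using eventually_at_right_less[of 0] by (rule eventually_mono) (rule P)
  ultimately show ?thesis
    by (intro tendsto_lowerbound[of P "P 0" "at_right 0" 0]) (auto simp only: trivial_limit_at_right_real)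
qed

text \<open>Continuity squeezes \<open>P 0\<close> between a nonnegative limit from the right and a
  nonpositive one from the left. It serves to cancel a factor \<open>t\<close> that may have either
  sign.\<close>

lemma isCont_sign_change_zero:
  fixes P :: "real \<Rightarrow> real"
  assumes cont: "isCont P 0" and sgn: "\<And>t. 0 \<le> t * P t"
  shows "P 0 = 0"
proof (rule antisym)
  have "0 \<le> P t" if "0 < t" for t
    using sgn[of t] that by (simp add: zero_le_mult_iff)
  with cont show "0 \<le> P 0" by (rule isCont_nonneg_limit[of P])
  have "isCont (\<lambda>t. - P (- t)) 0"
    by (rule isCont_minus, rule isCont_o2[where g = P]) (use cont in auto)
  moreover have "0 \<le> - P (- t)" if "0 < t" for t
    using sgn[of "- t"] that by (simp add: mult_le_0_iff)
  ultimately have "0 \<le> - P (- 0)" by (rule isCont_nonneg_limit[of "\<lambda>t. - P (- t)"])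
  then show "P 0 \<le> 0" by simp
qed

section \<open>Quadratic functions on spheres in a subspace\<close>

text \<open>The Lagrange condition in Galerkin form: the residual is only orthogonal to
  \<open>V\<close>. This covers both an invariant \<open>V\<close>, where the residual then
  vanishes, and a Krylov space, which \<open>f\<close> may leave.\<close>

definition sphere_critical ::
    "('a::real_inner \<Rightarrow> 'a) \<Rightarrow> 'a \<Rightarrow> 'a set \<Rightarrow> real \<Rightarrow> real \<Rightarrow> 'a \<Rightarrow> bool" where
  "sphere_critical f g V r l u \<longleftrightarrow>
     u \<in> V \<and> norm u = r \<and> (\<forall>d\<in>V. d \<bullet> (f u + g - l *\<^sub>R u) = 0)"

definition quad_obj :: "('a::real_inner \<Rightarrow> 'a) \<Rightarrow> 'a \<Rightarrow> 'a \<Rightarrow> real" where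
  "quad_obj f g w = w \<bullet> f w + 2 * (g \<bullet> w)"

definition min_critical ::
    "('a::real_inner \<Rightarrow> 'a) \<Rightarrow> 'a \<Rightarrow> 'a set \<Rightarrow> real \<Rightarrow> real \<Rightarrow> 'a \<Rightarrow> bool" where
  "min_critical f g V r l u \<longleftrightarrow>
     sphere_critical f g V r l u \<and> (\<forall>l' u'. sphere_critical f g V r l' u' \<longrightarrow> l \<le> l')"

text \<open>Operators instead of matrices, so that the locale can be interpreted again for shifts
  and affine rescalings of \<open>f\<close>.\<close>

locale self_adjoint_operator =
  fixes f :: "'a::euclidean_space \<Rightarrow> 'a"
  assumes linear: "linear f"
    and self_adjoint: "f x \<bullet> y = x \<bullet> f y"
begin

lemmas f_simps = linear_add[OF linear] linear_diff[OF linear] linear_scale[OF linear]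
  linear_neg[OF linear] linear_0[OF linear]

lemma inner_f_swap: "x \<bullet> f y = y \<bullet> f x"
  using self_adjoint[of y x] by (simp add: inner_commute)

text \<open>With \<open>d = w - u\<close>, the first-order term is
  \<open>2 * l * (d \<bullet> u)\<close> by criticality, and equal norms give
  \<open>2 * (d \<bullet> u) = - (d \<bullet> d)\<close>. Hence the form of \<open>f - l\<close>
  alone decides optimality.\<close>

lemma quad_obj_diff:
  assumes V: "subspace V" and u: "sphere_critical f g V r l u" and w: "w \<in> V" "norm w = r"
  shows "quad_obj f g w - quad_obj f g u = (w - u) \<bullet> (f (w - u) - l *\<^sub>R (w - u))"
proof -
  have "(w - u) \<bullet> (f u + g - l *\<^sub>R u) = 0"
    using u w V by (auto simp: sphere_critical_def subspace_diff)
  moreover have "w \<bullet> w = r\<^sup>2" "u \<bullet> u = r\<^sup>2"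
    using u w by (auto simp: sphere_critical_def dot_square_norm)
  ultimately show ?thesis
    using inner_f_swap[of u w]
    by (simp add: quad_obj_def f_simps inner_diff inner_add inner_commute algebra_simps)
qed

text \<open>Reflecting \<open>u\<close> in the hyperplane orthogonal to \<open>d\<close> stays in
  \<open>V\<close> and on the sphere, so the objective cannot drop. Clearing denominators gives one
  inequality that contains both the first-order and the second-order conditions.\<close>

lemma reflection_inequality:
  assumes V: "subspace V" and u: "u \<in> V" "norm u = r"
    and min: "\<And>w. w \<in> V \<Longrightarrow> norm w = r \<Longrightarrow> quad_obj f g u \<le> quad_obj f g w"
    and d: "d \<in> V"
  shows "0 \<le> (d \<bullet> u) * ((d \<bullet> u) * (d \<bullet> f d) - (d \<bullet> d) * (d \<bullet> (f u + g)))"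
proof (cases "d = 0")
  case False
  define c where "c = 2 * (d \<bullet> u) / (d \<bullet> d)"
  define w where "w = u - c *\<^sub>R d"
  have D: "0 < d \<bullet> d" using False by simp
  have "w \<bullet> w = u \<bullet> u - 2 * c * (d \<bullet> u) + c\<^sup>2 * (d \<bullet> d)"
    by (simp add: w_def inner_diff inner_commute power2_eq_square algebra_simps)
  also have "\<dots> = u \<bullet> u"
    using D by (simp add: c_def power2_eq_square field_simps)
  finally have "norm w = r"
    using u by (simp add: norm_eq_sqrt_inner)
  then have "quad_obj f g u \<le> quad_obj f g w"
    using V u d by (intro min) (auto simp: w_def subspace_diff subspace_scale)
  then have "0 \<le> c\<^sup>2 * (d \<bullet> f d) - 2 * c * (d \<bullet> (f u + g))"
    using inner_f_swap[of u d]
    by (simp add: w_def quad_obj_def f_simps inner_diff inner_add inner_commute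
        power2_eq_square algebra_simps)
  then have "0 \<le> (d \<bullet> d)\<^sup>2 / 4 * (c\<^sup>2 * (d \<bullet> f d) - 2 * c * (d \<bullet> (f u + g)))"
    by (intro mult_nonneg_nonneg) auto
  also have "\<dots> = (d \<bullet> u) * ((d \<bullet> u) * (d \<bullet> f d) - (d \<bullet> d) * (d \<bullet> (f u + g)))"
    using D by (simp add: c_def power2_eq_square field_simps)
  finally show ?thesis .
qed simp

text \<open>The reflection inequality says nothing about directions orthogonal to \<open>u\<close>;
  these are tilted by \<open>t *\<^sub>R u\<close> and recovered as \<open>t\<close> tends to
  0.\<close>

lemma minimizer_critical:
  assumes V: "subspace V" and r: "0 < r" and u: "u \<in> V" "norm u = r"
    and min: "\<And>w. w \<in> V \<Longrightarrow> norm w = r \<Longrightarrow> quad_obj f g u \<le> quad_obj f g w"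
  shows "\<exists>l. sphere_critical f g V r l u \<and> (\<forall>d\<in>V. l * (d \<bullet> d) \<le> d \<bullet> f d)"
proof -
  have refl: "0 \<le> (d \<bullet> u) * ((d \<bullet> u) * (d \<bullet> f d) - (d \<bullet> d) * (d \<bullet> (f u + g)))"
    if "d \<in> V" for d
    using min by (rule reflection_inequality[OF V u _ that])
  have uu: "u \<bullet> u = r\<^sup>2" using u by (simp add: dot_square_norm)
  define h where "h = f u + g"
  \<comment> \<open>The only candidate for the multiplier: it makes \<open>h - l *\<^sub>R u\<close>
    orthogonal to \<open>u\<close>.\<close>
  define l where "l = (u \<bullet> h) / r\<^sup>2"
  have lu: "u \<bullet> h = l * r\<^sup>2" using r by (simp add: l_def)
  have orth: "e \<bullet> h = 0" if e: "e \<in> V" "e \<bullet> u = 0" for e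
  proof -
    \<comment> \<open>The reflection inequality for the direction \<open>e + t *\<^sub>R u\<close>,
      whose product with \<open>u\<close> is \<open>t * r\<^sup>2\<close>, reads
      \<open>0 \<le> t * P t\<close>. At 0 the value is
      \<open>- r\<^sup>2 * (e \<bullet> e) * (e \<bullet> h)\<close>.\<close>
    define P where "P t = r\<^sup>2 * (t * r\<^sup>2 * (e \<bullet> f e + 2 * t * (e \<bullet> f u) + t\<^sup>2 * (u \<bullet> f u))
        - (e \<bullet> e + t\<^sup>2 * r\<^sup>2) * (e \<bullet> h + t * (l * r\<^sup>2)))" for t
    have "isCont P 0" unfolding P_def by (intro continuous_intros)
    moreover have "0 \<le> t * P t" for t
    proof -
      have "e + t *\<^sub>R u \<in> V" using e u V by (simp add: subspace_add subspace_scale)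
      from refl[OF this] have "0 \<le> ((e + t *\<^sub>R u) \<bullet> u) * (((e + t *\<^sub>R u) \<bullet> u) *
          ((e + t *\<^sub>R u) \<bullet> f (e + t *\<^sub>R u))
          - ((e + t *\<^sub>R u) \<bullet> (e + t *\<^sub>R u)) * ((e + t *\<^sub>R u) \<bullet> h))"
        by (simp add: h_def)
      moreover have "(e + t *\<^sub>R u) \<bullet> u = t * r\<^sup>2"
        using e uu by (simp add: inner_add_left)
      moreover have "(e + t *\<^sub>R u) \<bullet> (e + t *\<^sub>R u) = e \<bullet> e + t\<^sup>2 * r\<^sup>2"
        using e uu by (simp add: inner_add inner_commute power2_eq_square)
      moreover have "(e + t *\<^sub>R u) \<bullet> h = e \<bullet> h + t * (l * r\<^sup>2)"
        using lu by (simp add: inner_add_left)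
      moreover have "(e + t *\<^sub>R u) \<bullet> f (e + t *\<^sub>R u) =
          e \<bullet> f e + 2 * t * (e \<bullet> f u) + t\<^sup>2 * (u \<bullet> f u)"
        using inner_f_swap[of u e]
        by (simp add: f_simps inner_add power2_eq_square distrib_left)
      ultimately show ?thesis
        by (simp add: P_def mult.assoc)
    qed
    ultimately have "P 0 = 0" by (rule isCont_sign_change_zero[of P])
    then show ?thesis using r by (auto simp: P_def)
  qed
  have crit: "d \<bullet> (h - l *\<^sub>R u) = 0" if d: "d \<in> V" for d
  proof -
    define e where "e = d - ((d \<bullet> u) / r\<^sup>2) *\<^sub>R u"
    have "e \<bullet> h = 0"
      using d u uu V r by (intro orth) (auto simp: e_def inner_diff subspace_diff subspace_scale)
    then show ?thesis using lu r by (simp add: e_def inner_diff)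
  qed
  have psd: "l * (d \<bullet> d) \<le> d \<bullet> f d" if d: "d \<in> V" for d
  proof -
    \<comment> \<open>For \<open>d\<close> not orthogonal to \<open>u\<close>, the critical equation
      turns the reflection inequality into the claim times
      \<open>(d \<bullet> u)\<^sup>2\<close>.\<close>
    have pos: "l * (d \<bullet> d) \<le> d \<bullet> f d" if d: "d \<in> V" and s: "d \<bullet> u \<noteq> 0" for d
    proof -
      have "d \<bullet> h = l * (d \<bullet> u)" using crit[OF d] by (simp add: inner_diff)
      then have "0 \<le> (d \<bullet> u)\<^sup>2 * (d \<bullet> f d - l * (d \<bullet> d))"
        using refl[OF d] unfolding h_def[symmetric] by (simp add: power2_eq_square algebra_simps)
      then show ?thesis using s by (simp add: zero_le_mult_iff)
    qed
    show ?thesis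
    proof (cases "d \<bullet> u = 0")
      case True
      define Q where "Q t = (d + t *\<^sub>R u) \<bullet> f (d + t *\<^sub>R u)
          - l * ((d + t *\<^sub>R u) \<bullet> (d + t *\<^sub>R u))" for t
      have Q: "Q t = d \<bullet> f d + 2 * t * (d \<bullet> f u) + t\<^sup>2 * (u \<bullet> f u) - l * (d \<bullet> d + t\<^sup>2 * r\<^sup>2)" for t
        using True uu inner_f_swap[of u d]
        by (simp add: Q_def f_simps inner_add inner_commute power2_eq_square algebra_simps)
      have "isCont Q 0" unfolding Q by (intro continuous_intros)
      moreover have "0 \<le> Q t" if "0 < t" for t
        using pos[of "d + t *\<^sub>R u"] that d u V True uu r
        by (simp add: Q_def subspace_add subspace_scale inner_add)
      ultimately have "0 \<le> Q 0" by (rule isCont_nonneg_limit[of Q])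
      then show ?thesis by (simp add: Q)
    qed (use pos d in auto)
  qed
  show ?thesis
    using u crit psd by (auto simp: sphere_critical_def h_def)
qed

text \<open>The sphere in \<open>V\<close> is compact, and nonempty because of \<open>v\<close>, so
  \<open>quad_obj\<close> attains its minimum there.\<close>

lemma sphere_critical_exists:
  assumes V: "subspace V" and r: "0 < r" and v: "v \<in> V" "v \<noteq> 0"
  shows "\<exists>l u. sphere_critical f g V r l u \<and> (\<forall>d\<in>V. l * (d \<bullet> d) \<le> d \<bullet> f d)"
proof -
  have "compact (V \<inter> sphere 0 r)"
    using V by (intro closed_Int_compact) (auto simp: closed_subspace)
  moreover have "(r / norm v) *\<^sub>R v \<in> V \<inter> sphere 0 r"
    using V v r by (auto simp: subspace_scale)
  then have "V \<inter> sphere 0 r \<noteq> {}" by blast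
  moreover have "continuous_on (V \<inter> sphere 0 r) f"
    using linear linear_conv_bounded_linear linear_continuous_on by blast
  then have "continuous_on (V \<inter> sphere 0 r) (quad_obj f g)"
    unfolding quad_obj_def by (intro continuous_intros)
  ultimately obtain u where u: "u \<in> V \<inter> sphere 0 r"
      "\<And>w. w \<in> V \<inter> sphere 0 r \<Longrightarrow> quad_obj f g u \<le> quad_obj f g w"
    using continuous_attains_inf[of "V \<inter> sphere 0 r" "quad_obj f g"] by blast
  have "\<exists>l. sphere_critical f g V r l u \<and> (\<forall>d\<in>V. l * (d \<bullet> d) \<le> d \<bullet> f d)"
    by (rule minimizer_critical[OF V r]) (use u in auto)
  then show ?thesis by blast
qed

text \<open>Some critical multiplier lies below all Rayleigh quotients on \<open>V\<close>, and the
  smallest critical multiplier is at most that one.\<close>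

lemma min_critical_psd:
  assumes "subspace V" "0 < r" "min_critical f g V r l u" "d \<in> V"
  shows "l * (d \<bullet> d) \<le> d \<bullet> f d"
proof -
  have "u \<in> V" "u \<noteq> 0"
    using assms by (auto simp: min_critical_def sphere_critical_def)
  then obtain l' u' where l': "sphere_critical f g V r l' u'" "\<forall>d\<in>V. l' * (d \<bullet> d) \<le> d \<bullet> f d"
    using sphere_critical_exists[OF assms(1,2)] by blast
  then have "l * (d \<bullet> d) \<le> l' * (d \<bullet> d)"
    using assms(3) by (intro mult_right_mono) (auto simp: min_critical_def)
  also have "\<dots> \<le> d \<bullet> f d" using l' assms(4) by blast
  finally show ?thesis .
qed

text \<open>Minimality of the multiplier becomes minimality of the objective: the difference of
  values is the form of \<open>f - l\<close>, which is nonnegative on \<open>V\<close>.\<close>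

lemma min_critical_minimizes:
  assumes V: "subspace V" and "0 < r" and u: "min_critical f g V r l u"
    and w: "w \<in> V" "norm w = r"
  shows "quad_obj f g u \<le> quad_obj f g w"
proof -
  have crit: "sphere_critical f g V r l u"
    using u by (simp add: min_critical_def)
  then have "w - u \<in> V"
    using V w by (auto simp: sphere_critical_def subspace_diff)
  then have "l * ((w - u) \<bullet> (w - u)) \<le> (w - u) \<bullet> f (w - u)"
    by (rule min_critical_psd[OF V \<open>0 < r\<close> u])
  then show ?thesis
    using quad_obj_diff[OF V crit w] by (simp add: inner_diff_right)
qed

section \<open>Spectral theorem on an invariant subspace\<close>

text \<open>Induction on the dimension: a critical pair for \<open>g = 0\<close> on the unit sphere
  is an eigenpair, and the orthogonal complement of its vector in \<open>S\<close> is again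
  invariant.\<close>

lemma orthonormal_eigenbasis:
  assumes "subspace S" and "f ` S \<subseteq> S"
  shows "\<exists>B. finite B \<and> pairwise orthogonal B \<and> span B = S \<and>
           (\<forall>b\<in>B. norm b = 1 \<and> (\<exists>t. f b = t *\<^sub>R b))"
  using assms
proof (induction "dim S" arbitrary: S)
  case 0
  then have "S = {0}" using dim_eq_0 subspace_0 by fastforce
  then show ?case by (intro exI[of _ "{}"]) auto
next
  case (Suc n)
  then obtain v where "v \<in> S" "v \<noteq> 0"
    by (metis dim_eq_0 nat.distinct(1) subset_iff singletonI)
  then obtain t u where u: "sphere_critical f 0 S 1 t u"
    using sphere_critical_exists[OF Suc.prems(1), of 1 v 0] by auto
  then have uS: "u \<in> S" "norm u = 1" by (auto simp: sphere_critical_def)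
  have "f u - t *\<^sub>R u \<in> S"
    using uS Suc.prems by (intro subspace_diff subspace_scale) auto
  \<comment> \<open>The residual lies in \<open>S\<close> and is orthogonal to \<open>S\<close>,
    hence to itself.\<close>
  then have eig: "f u = t *\<^sub>R u"
    using u by (auto simp: sphere_critical_def)
  define S' where "S' = S \<inter> {y. orthogonal u y}"
  have sub': "subspace S'"
    unfolding S'_def by (intro subspace_inter Suc.prems subspace_orthogonal_to_vector)
  have inv': "f ` S' \<subseteq> S'"
    using Suc.prems eig by (auto simp: S'_def orthogonal_def self_adjoint[symmetric])
  have uu: "u \<bullet> u = 1" using uS by (simp add: dot_square_norm)
  have S_eq: "S = span (insert u S')"
  proof
    show "S \<subseteq> span (insert u S')"
    proof
      fix y assume y: "y \<in> S"
      have "y - (u \<bullet> y) *\<^sub>R u \<in> S'"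
        using y uS uu Suc.prems
        by (auto simp: S'_def orthogonal_def inner_diff subspace_diff subspace_scale)
      then have "(y - (u \<bullet> y) *\<^sub>R u) + (u \<bullet> y) *\<^sub>R u \<in> span (insert u S')"
        by (intro span_add span_scale) (auto intro: span_base)
      then show "y \<in> span (insert u S')" by simp
    qed
    show "span (insert u S') \<subseteq> S"
      using uS Suc.prems by (intro span_minimal) (auto simp: S'_def)
  qed
  have "u \<notin> S'" using uu by (auto simp: S'_def orthogonal_def)
  then have "u \<notin> span S'" using sub' span_eq_iff by blast
  then have "dim S = Suc (dim S')" by (subst S_eq) (simp add: dim_insert)
  then obtain B where B: "finite B" "pairwise orthogonal B" "span B = S'"
      "\<forall>b\<in>B. norm b = 1 \<and> (\<exists>t. f b = t *\<^sub>R b)"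
    using Suc.hyps(1)[OF _ sub' inv'] Suc.hyps(2) by auto
  have "orthogonal u b" if "b \<in> B" for b
    using span_base[OF that] B(3) by (auto simp: S'_def)
  then have "pairwise orthogonal (insert u B)"
    using B(2) by (auto simp: pairwise_insert orthogonal_commute)
  moreover have "span (insert u B) = S"
    unfolding S_eq B(3)[symmetric] by (simp add: span_insert span_span)
  ultimately show ?case
    using B uS eig by (intro exI[of _ "insert u B"]) auto
qed

end

lemma orthonormal_parseval:
  assumes "finite B" "pairwise orthogonal B" "\<And>b. b \<in> B \<Longrightarrow> norm b = 1" "x \<in> span B"
  shows "(norm x)\<^sup>2 = (\<Sum>b\<in>B. (x \<bullet> b)\<^sup>2)"
proof -
  have "(norm x)\<^sup>2 = x \<bullet> (\<Sum>b\<in>B. (x \<bullet> b) *\<^sub>R b)"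
    using orthonormal_basis_expand[OF assms(2,3,4,1)] by (simp add: dot_square_norm)
  then show ?thesis by (simp add: inner_sum_right power2_eq_square)
qed

section \<open>Chebyshev iteration\<close>

text \<open>The Chebyshev recurrence: the value is \<open>T_n(f) u\<close>. With \<open>f\<close>
  multiplication by \<open>t\<close> and \<open>u = 1\<close> it is the scalar
  \<open>T_n(t)\<close>, so one definition serves operators and numbers.\<close>

fun cheb_iter :: "('a::real_vector \<Rightarrow> 'a) \<Rightarrow> 'a \<Rightarrow> nat \<Rightarrow> 'a" where
  "cheb_iter f u 0 = u"
| "cheb_iter f u (Suc 0) = f u"
| "cheb_iter f u (Suc (Suc n)) = 2 *\<^sub>R f (cheb_iter f u (Suc n)) - cheb_iter f u n"

lemma cheb_iter_cos: "cheb_iter (\<lambda>y. cos x * y) 1 n = cos (real n * x)"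
proof (induction n rule: induct_nat_012)
  case (ge2 n)
  have "cos (real (Suc (Suc n)) * x) = cos (real (Suc n) * x + x)"
    "cos (real n * x) = cos (real (Suc n) * x - x)"
    by (simp_all add: algebra_simps)
  then have "cos (real (Suc (Suc n)) * x) = 2 * (cos x * cos (real (Suc n) * x)) - cos (real n * x)"
    unfolding cos_add cos_diff by (simp add: mult.commute)
  then show ?case using ge2 by simp
qed auto

lemma abs_cheb_iter_le_1:
  fixes t :: real
  assumes "\<bar>t\<bar> \<le> 1"
  shows "\<bar>cheb_iter (\<lambda>y. t * y) 1 n\<bar> \<le> 1"
  using cheb_iter_cos[of "arccos t" n] assms by (simp add: cos_arccos_abs)

text \<open>Both sides satisfy the same recurrence. This evaluates \<open>T_n\<close> outside
  \<open>[-1, 1]\<close>, where its size yields the convergence rate.\<close>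

lemma cheb_iter_joukowski:
  fixes z t :: real
  assumes "z \<noteq> 0" "2 * t = z + inverse z"
  shows "2 * cheb_iter (\<lambda>y. t * y) 1 n = z ^ n + inverse z ^ n"
proof (induction n rule: induct_nat_012)
  case (ge2 n)
  have "2 * cheb_iter (\<lambda>y. t * y) 1 (Suc (Suc n)) =
      (2 * t) * (2 * cheb_iter (\<lambda>y. t * y) 1 (Suc n)) - 2 * cheb_iter (\<lambda>y. t * y) 1 n"
    by simp
  also have "\<dots> = (z + inverse z) * (z ^ Suc n + inverse z ^ Suc n) - (z ^ n + inverse z ^ n)"
    by (simp only: ge2 assms)
  also have "\<dots> = z ^ Suc (Suc n) + inverse z ^ Suc (Suc n)"
  proof -
    obtain w where w: "inverse z = w" "z * w = 1" using assms(1) by simp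
    have zw: "z * (w * y) = y" "w * (z * y) = y" for y
      using w(2) by (metis mult.assoc mult.commute mult_1)+
    show ?thesis unfolding w(1) by (simp add: distrib_left distrib_right zw)
  qed
  finally show ?case .
qed (use assms in auto)

context self_adjoint_operator
begin

lemma inner_cheb_iter_eigenvector:
  assumes "f b = t *\<^sub>R b"
  shows "cheb_iter f u n \<bullet> b = cheb_iter (\<lambda>y. t * y) 1 n * (u \<bullet> b)"
  by (induction n rule: induct_nat_012)
    (use assms in \<open>auto simp: self_adjoint inner_diff_left algebra_simps\<close>)

text \<open>In an eigenbasis each coordinate is multiplied by \<open>T_n(t)\<close>. The Rayleigh
  bound gives \<open>\<bar>t\<bar> \<le> 1\<close>, so no coordinate grows.\<close>

lemma norm_cheb_iter_le:
  assumes S: "subspace S" "f ` S \<subseteq> S" and u: "u \<in> S"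
    and contr: "\<And>y. y \<in> S \<Longrightarrow> \<bar>y \<bullet> f y\<bar> \<le> y \<bullet> y"
  shows "norm (cheb_iter f u n) \<le> norm u"
proof -
  obtain B where B: "finite B" "pairwise orthogonal B" "span B = S"
      "\<And>b. b \<in> B \<Longrightarrow> norm b = 1" "\<And>b. b \<in> B \<Longrightarrow> \<exists>t. f b = t *\<^sub>R b"
    using orthonormal_eigenbasis[OF S] by blast
  have fS: "f y \<in> S" if "y \<in> S" for y
    using S(2) that by blast
  have mem: "cheb_iter f u n \<in> S"
    by (induction n rule: induct_nat_012) (simp_all add: S(1) u fS subspace_diff subspace_scale)
  have "(norm (cheb_iter f u n))\<^sup>2 = (\<Sum>b\<in>B. (cheb_iter f u n \<bullet> b)\<^sup>2)"
    using B mem by (intro orthonormal_parseval) auto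
  also have "\<dots> \<le> (\<Sum>b\<in>B. (u \<bullet> b)\<^sup>2)"
  proof (rule sum_mono)
    fix b assume b: "b \<in> B"
    then obtain t where t: "f b = t *\<^sub>R b" using B by blast
    have "b \<in> S" using b B span_base by blast
    moreover have "b \<bullet> b = 1" using B(4)[OF b] by (simp add: dot_square_norm)
    ultimately have "\<bar>t\<bar> \<le> 1" using contr[of b] t by simp
    then have "\<bar>cheb_iter f u n \<bullet> b\<bar> \<le> \<bar>u \<bullet> b\<bar>"
      using abs_cheb_iter_le_1[of t n]
      by (simp add: inner_cheb_iter_eigenvector[OF t] abs_mult mult_left_le_one_le)
    then show "(cheb_iter f u n \<bullet> b)\<^sup>2 \<le> (u \<bullet> b)\<^sup>2"
      by (simp add: abs_le_square_iff)
  qed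
  also have "\<dots> = (norm u)\<^sup>2"
    using B u by (intro orthonormal_parseval[symmetric]) auto
  finally show ?thesis by (rule power2_le_imp_le) simp
qed

end

section \<open>Chebyshev approximation from nested Krylov-type spaces\<close>

definition cheb_factor :: "real \<Rightarrow> nat \<Rightarrow> real" where
  "cheb_factor \<kappa> k =
     (let \<Gamma> = (sqrt \<kappa> + 1) / (sqrt \<kappa> - 1) in inverse (\<Gamma> ^ k + inverse \<Gamma> ^ k))"

context self_adjoint_operator
begin

text \<open>The factor \<open>2 cheb_factor\<close> is the sup norm on the spectrum \<open>[\<alpha>, \<beta>]\<close> of the rescaled
  Chebyshev polynomial of degree \<open>k\<close> that takes the value 1 at 0. For \<open>\<alpha> = \<beta>\<close> the division by
  zero in \<open>cheb_factor\<close> returns 0, in accordance with exact termination after one step.\<close>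
lemma krylov_solution_error:
  assumes S: "subspace S" "f ` S \<subseteq> S" and u: "u \<in> S"
    and lo: "\<And>y. y \<in> S \<Longrightarrow> \<alpha> * (y \<bullet> y) \<le> y \<bullet> f y"
    and hi: "\<And>y. y \<in> S \<Longrightarrow> y \<bullet> f y \<le> \<beta> * (y \<bullet> y)"
    and \<alpha>: "0 < \<alpha>" "\<alpha> \<le> \<beta>"
    and K: "\<And>k. subspace (K k)" "\<And>k. K k \<subseteq> K (Suc k)" "\<And>k. f ` K k \<subseteq> K (Suc k)"
    and fu: "f u \<in> K 1" and k: "1 \<le> k"
  shows "\<exists>w\<in>K k. norm (w - u) \<le> 2 * norm u * cheb_factor (\<beta> / \<alpha>) k"
proof (cases "\<alpha> = \<beta>")
  case True
  obtain B where B: "finite B" "span B = S" "pairwise orthogonal B"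
      "\<And>b. b \<in> B \<Longrightarrow> norm b = 1" "\<And>b. b \<in> B \<Longrightarrow> \<exists>t. f b = t *\<^sub>R b"
    using orthonormal_eigenbasis[OF S] by blast
  \<comment> \<open>With coinciding bounds \<open>f\<close> is \<alpha> times the identity on
    \<open>S\<close>, so \<open>u\<close> is a multiple of \<open>f u\<close> and already lies in
    \<open>K 1\<close>.\<close>
  have "f b = \<alpha> *\<^sub>R b" if b: "b \<in> B" for b
  proof -
    obtain t where t: "f b = t *\<^sub>R b" using B b by blast
    have "b \<in> S" using b B span_base by blast
    moreover have "b \<bullet> b = 1" using B(4)[OF b] by (simp add: dot_square_norm)
    ultimately have "t = \<alpha>" using lo[of b] hi[of b] t True by simp
    then show ?thesis using t by simp
  qed
  then have "f u = \<alpha> *\<^sub>R u"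
    using linear_eq_on_span[OF linear, of "\<lambda>y. \<alpha> *\<^sub>R y" B] u B(2)
    by (auto simp: linear_compose_scale_right)
  then have "u = inverse \<alpha> *\<^sub>R f u" using \<alpha> by simp
  then have "u \<in> K 1" using fu K(1) by (metis subspace_scale)
  then have "u \<in> K k" using lift_Suc_mono_le[of K, OF K(2) k] by blast
  moreover have "cheb_factor (\<beta> / \<alpha>) k = 0"
    using True \<alpha> k by (simp add: cheb_factor_def power_0_left)
  ultimately show ?thesis by (intro bexI[of _ u]) auto
next
  case False
  define \<kappa> where "\<kappa> = \<beta> / \<alpha>"
  define \<Gamma> where "\<Gamma> = (sqrt \<kappa> + 1) / (sqrt \<kappa> - 1)"
  \<comment> \<open>The affine map behind \<open>h\<close> sends \<alpha> to 1, \<beta> to -1 and 0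
    to \<open>s\<close>. Thus \<open>h\<close> is a contraction on \<open>S\<close>, while
    \<open>\<tau> k = T_k(s)\<close> is large.\<close>
  define s where "s = (\<alpha> + \<beta>) / (\<beta> - \<alpha>)"
  define h where "h y = s *\<^sub>R y - (2 / (\<beta> - \<alpha>)) *\<^sub>R f y" for y
  define e where "e = cheb_iter h u"
  define \<tau> where "\<tau> = cheb_iter (\<lambda>y. s * y) 1"
  have ab: "\<alpha> < \<beta>" using False \<alpha> by simp
  have "linear h" unfolding h_def
    by (rule linearI) (simp_all add: f_simps algebra_simps)
  then interpret h: self_adjoint_operator h
    by (rule self_adjoint_operator.intro) (auto simp: h_def inner_diff self_adjoint)
  have hS: "h ` S \<subseteq> S"
    using S by (auto simp: h_def intro!: subspace_diff subspace_scale)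
  have "\<bar>y \<bullet> h y\<bar> \<le> y \<bullet> y" if "y \<in> S" for y
  proof -
    have "y \<bullet> h y = ((\<alpha> + \<beta>) * (y \<bullet> y) - 2 * (y \<bullet> f y)) / (\<beta> - \<alpha>)"
      by (simp add: h_def s_def inner_diff diff_divide_distrib)
    then show ?thesis
      using lo[OF that] hi[OF that] ab
      by (simp add: abs_le_iff minus_divide_left pos_divide_le_eq algebra_simps)
  qed
  then have e_norm: "norm (e k) \<le> norm u"
    unfolding e_def by (rule h.norm_cheb_iter_le[OF S(1) hS u])
  have hK: "h y \<in> K (Suc j)" if "y \<in> K j" for y j
    using that K[of j] K(1)[of "Suc j"] by (auto simp: h_def intro!: subspace_diff subspace_scale)
  have h_res: "h u - s *\<^sub>R u \<in> K (Suc j)" for j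
  proof -
    have "- (2 / (\<beta> - \<alpha>)) *\<^sub>R f u \<in> K 1" using fu K(1) by (intro subspace_scale)
    then have "h u - s *\<^sub>R u \<in> K 1" by (simp add: h_def)
    then show ?thesis using lift_Suc_mono_le[of K 1 "Suc j", OF K(2)] by auto
  qed
  \<comment> \<open>The polynomial \<open>T_j(h) - T_j(s)\<close> is divisible by \<open>f\<close>,
    so applied to \<open>u\<close> it is a polynomial of degree below \<open>j\<close> applied to
    \<open>f u\<close>. The induction keeps the defect \<open>h u - s *\<^sub>R u\<close>, a
    multiple of \<open>f u\<close>, separate.\<close>
  have step: "e j - \<tau> j *\<^sub>R u \<in> K j" for j
  proof (induction j rule: induct_nat_012)
    case 0
    then show ?case using K(1) by (simp add: e_def \<tau>_def subspace_0)
  next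
    case 1
    then show ?case using h_res[of 0] by (simp add: e_def \<tau>_def)
  next
    case (ge2 j)
    have "e (Suc (Suc j)) - \<tau> (Suc (Suc j)) *\<^sub>R u =
        2 *\<^sub>R h (e (Suc j) - \<tau> (Suc j) *\<^sub>R u) + (2 * \<tau> (Suc j)) *\<^sub>R (h u - s *\<^sub>R u)
        - (e j - \<tau> j *\<^sub>R u)"
      by (simp add: e_def \<tau>_def h.f_simps algebra_simps)
    also have "\<dots> \<in> K (Suc (Suc j))"
    proof -
      have "e j - \<tau> j *\<^sub>R u \<in> K (Suc (Suc j))"
        using ge2(1) K(2)[of j] K(2)[of "Suc j"] by (meson subsetD)
      then show ?thesis
        using hK[OF ge2(2)] h_res[of "Suc j"] K(1)[of "Suc (Suc j)"]
        by (simp add: subspace_diff subspace_add subspace_scale)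
    qed
    finally show ?case .
  qed
  have \<kappa>1: "1 < \<kappa>" using ab \<alpha> by (simp add: \<kappa>_def)
  then have sq: "1 < sqrt \<kappa>" "sqrt \<kappa> * sqrt \<kappa> = \<kappa>" by auto
  then have \<Gamma>: "0 < \<Gamma>" unfolding \<Gamma>_def by (intro divide_pos_pos) linarith+
  \<comment> \<open>This value is \<open>2 * s\<close>, so the closed form of \<open>T_k(s)\<close>
    applies with \<open>z = \<Gamma>\<close>.\<close>
  have "\<Gamma> + inverse \<Gamma> = 2 * (\<kappa> + 1) / (\<kappa> - 1)"
  proof -
    have "\<kappa> - 1 = (sqrt \<kappa> + 1) * (sqrt \<kappa> - 1)" using sq(2) by (simp add: algebra_simps)
    moreover have "\<Gamma> + inverse \<Gamma> =
        ((sqrt \<kappa> + 1) * (sqrt \<kappa> + 1) + (sqrt \<kappa> - 1) * (sqrt \<kappa> - 1)) / ((sqrt \<kappa> + 1) * (sqrt \<kappa> - 1))"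
    proof -
      have "sqrt \<kappa> + 1 \<noteq> 0" "sqrt \<kappa> - 1 \<noteq> 0" using sq(1) by linarith+
      then show ?thesis
        unfolding \<Gamma>_def inverse_divide by (subst add_frac_eq) (simp_all add: mult.commute)
    qed
    ultimately show ?thesis using sq(2) by (simp add: algebra_simps)
  qed
  also have "\<dots> = 2 * s"
    using \<alpha> ab by (simp add: s_def \<kappa>_def field_simps)
  finally have \<tau>: "2 * \<tau> k = \<Gamma> ^ k + inverse \<Gamma> ^ k"
    unfolding \<tau>_def using \<Gamma> by (intro cheb_iter_joukowski) auto
  have \<tau>_pos: "0 < \<tau> k"
    using \<tau> \<Gamma> by (smt (verit) zero_less_power positive_imp_inverse_positive)
  have cf: "2 * cheb_factor \<kappa> k = inverse (\<tau> k)"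
    unfolding cheb_factor_def Let_def \<Gamma>_def[symmetric] \<tau>[symmetric] by simp
  \<comment> \<open>Normalizing by \<open>T_k(s)\<close> makes the error polynomial equal to 1 at 0,
    which leaves \<open>w - u = - T_k(h) u / T_k(s)\<close>.\<close>
  define w where "w = - (inverse (\<tau> k) *\<^sub>R (e k - \<tau> k *\<^sub>R u))"
  have "w \<in> K k" using step K(1) by (simp add: w_def subspace_neg subspace_scale)
  moreover have "w - u = - (inverse (\<tau> k) *\<^sub>R e k)"
    using \<tau>_pos by (simp add: w_def algebra_simps)
  then have "norm (w - u) \<le> inverse (\<tau> k) * norm u"
    using \<tau>_pos e_norm by (simp add: mult_left_mono)
  ultimately show ?thesis
    using cf by (auto simp: \<kappa>_def[symmetric] mult_ac intro!: bexI[of _ w])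
qed

end

section \<open>Error bounds for the restricted sphere problem\<close>

context self_adjoint_operator
begin

text \<open>Pairing the critical equation with \<open>u\<close> expresses the multiplier through the
  objective, so multiplier errors reduce to errors of the objective and of the vector.\<close>

lemma sphere_critical_multiplier:
  assumes "sphere_critical f g V r l u"
  shows "l * r\<^sup>2 = quad_obj f g u - g \<bullet> u"
proof -
  have "u \<bullet> (f u + g - l *\<^sub>R u) = 0" "u \<bullet> u = r\<^sup>2"
    using assms by (auto simp: sphere_critical_def dot_square_norm)
  then show ?thesis
    by (simp add: quad_obj_def inner_diff inner_add inner_commute)
qed

text \<open>A quasi-optimality argument: the objective gap is the energy of the error for
  \<open>f - l\<close>, whose spectral bounds on \<open>S\<close> are \<alpha> and \<beta>, and
  \<open>v\<close> has the smallest gap on the sphere in \<open>K k\<close>. A single good test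
  vector therefore controls everything.\<close>

lemma min_critical_krylov_error:
  assumes S: "subspace S" "f ` S \<subseteq> S" and r: "0 < r" and g: "g \<in> S"
    and u: "sphere_critical f g S r l u"
    and lo: "\<And>y. y \<in> S \<Longrightarrow> (l + \<alpha>) * (y \<bullet> y) \<le> y \<bullet> f y"
    and hi: "\<And>y. y \<in> S \<Longrightarrow> y \<bullet> f y \<le> (l + \<beta>) * (y \<bullet> y)"
    and \<alpha>: "0 < \<alpha>" "\<alpha> \<le> \<beta>"
    and K: "\<And>k. subspace (K k)" "\<And>k. K k \<subseteq> K (Suc k)" "\<And>k. f ` K k \<subseteq> K (Suc k)"
      "\<And>k. K k \<subseteq> S" "g \<in> K 1" and k: "1 \<le> k"
    and v: "min_critical f g (K k) r m v"
  defines "c \<equiv> cheb_factor (\<beta> / \<alpha>) k"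
  shows "0 \<le> quad_obj f g v - quad_obj f g u"
    and "quad_obj f g v - quad_obj f g u \<le> 16 * r\<^sup>2 * \<beta> * c\<^sup>2"
    and "norm (v - u) \<le> 4 * r * sqrt (\<beta> / \<alpha>) * c"
    and "\<bar>m - l\<bar> \<le> 16 * \<beta> * c\<^sup>2 + 4 / r * norm g * sqrt (\<beta> / \<alpha>) * c"
proof -
  define F where "F y = f y - l *\<^sub>R y" for y
  have "linear F" unfolding F_def
    by (rule linearI) (simp_all add: f_simps algebra_simps)
  then interpret F: self_adjoint_operator F
    by (rule self_adjoint_operator.intro) (auto simp: F_def inner_diff self_adjoint)
  have uS: "u \<in> S" "norm u = r" using u by (auto simp: sphere_critical_def)
  have FS: "F ` S \<subseteq> S"
    using S by (auto simp: F_def intro!: subspace_diff subspace_scale)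
  have "F u + g \<in> S"
    using FS uS g S by (auto intro!: subspace_add)
  moreover have "f u + g - l *\<^sub>R u = F u + g" by (simp add: F_def)
  ultimately have "(F u + g) \<bullet> (F u + g) = 0"
    using u unfolding sphere_critical_def by metis
  then have Fu: "F u = - g" by (simp add: eq_neg_iff_add_eq_0)
  have Flo: "\<alpha> * (y \<bullet> y) \<le> y \<bullet> F y" and Fhi: "y \<bullet> F y \<le> \<beta> * (y \<bullet> y)" if "y \<in> S" for y
    using lo[OF that] hi[OF that] by (simp_all add: F_def inner_diff algebra_simps)
  have FK: "F ` K j \<subseteq> K (Suc j)" for j
    using K(2,3)[of j] K(1)[of "Suc j"] by (auto simp: F_def intro!: subspace_diff subspace_scale)
  have FuK: "F u \<in> K 1" using Fu K(1,5) by (simp add: subspace_neg)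
  then obtain w0 where w0: "w0 \<in> K k" "norm (w0 - u) \<le> 2 * r * c"
    using F.krylov_solution_error[OF S(1) FS uS(1) Flo Fhi \<alpha> K(1,2) FK FuK k] uS(2)
    unfolding c_def by blast
  have "0 \<le> 2 * r * c" using w0(2) norm_ge_zero order_trans by blast
  then have c: "0 \<le> c" using r by (simp add: zero_le_mult_iff)
  have vK: "v \<in> K k" "norm v = r" and crit_v: "sphere_critical f g (K k) r m v"
    using v by (auto simp: min_critical_def sphere_critical_def)
  \<comment> \<open>Scaling \<open>w0\<close> to norm \<open>r\<close> moves it by the difference of
    the norms of \<open>u\<close> and \<open>w0\<close>, at most the distance of \<open>w0\<close>
    from \<open>u\<close>. For \<open>w0 = 0\<close> there is no direction to scale, but that
    distance is then \<open>r\<close>, and \<open>v\<close> itself is within \<open>2 * r\<close> of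
    \<open>u\<close>.\<close>
  obtain w where w: "w \<in> K k" "norm w = r" "norm (w - u) \<le> 2 * norm (w0 - u)"
  proof (cases "w0 = 0")
    case True
    have "norm (v - u) \<le> 2 * norm (w0 - u)"
      using norm_triangle_ineq4[of v u] True vK uS by simp
    then show thesis using that vK by blast
  next
    case False
    define w where "w = (r / norm w0) *\<^sub>R w0"
    have "w - w0 = ((r - norm w0) / norm w0) *\<^sub>R w0"
      using False by (simp add: w_def diff_divide_distrib scaleR_diff_left)
    then have "norm (w - w0) = \<bar>norm u - norm w0\<bar>" using False uS by simp
    also have "\<dots> \<le> norm (w0 - u)"
      using norm_triangle_ineq3[of u w0] by (simp add: norm_minus_commute)
    finally have "norm (w - u) \<le> 2 * norm (w0 - u)"
      using norm_triangle_ineq[of "w - w0" "w0 - u"] by simp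
    moreover have "w \<in> K k" "norm w = r"
      using w0 K(1) r False by (auto simp: w_def subspace_scale)
    ultimately show thesis using that by blast
  qed
  have w_err: "norm (w - u) \<le> 4 * r * c" using w w0 by simp
  have diff: "quad_obj f g y - quad_obj f g u = (y - u) \<bullet> F (y - u)"
    if "y \<in> K k" "norm y = r" for y
    unfolding F_def using that K(4) by (intro quad_obj_diff[OF S(1) u]) auto
  have in_S: "y - u \<in> S" if "y \<in> K k" for y
    using that K(4) uS S by (auto intro!: subspace_diff)
  have dv: "\<alpha> * (norm (v - u))\<^sup>2 \<le> quad_obj f g v - quad_obj f g u"
    using Flo[OF in_S[OF vK(1)]] diff[OF vK] by (simp add: dot_square_norm)
  show nonneg: "0 \<le> quad_obj f g v - quad_obj f g u"
    using dv \<alpha> by (meson less_imp_le mult_nonneg_nonneg order_trans zero_le_power2)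
  have "quad_obj f g v \<le> quad_obj f g w"
    using w by (intro min_critical_minimizes[OF K(1) r v])
  then have "quad_obj f g v - quad_obj f g u \<le> \<beta> * (norm (w - u))\<^sup>2"
    using Fhi[OF in_S[OF w(1)]] diff[OF w(1,2)] by (simp add: dot_square_norm)
  also have "\<dots> \<le> \<beta> * (4 * r * c)\<^sup>2"
    using \<alpha> w_err by (intro mult_left_mono power_mono) auto
  finally have obj: "quad_obj f g v - quad_obj f g u \<le> \<beta> * (4 * r * c)\<^sup>2" .
  then show obj': "quad_obj f g v - quad_obj f g u \<le> 16 * r\<^sup>2 * \<beta> * c\<^sup>2"
    by (simp add: power_mult_distrib mult_ac)
  \<comment> \<open>Coercivity with \<alpha> below and the test vector's energy with \<beta> above
    produce the condition number.\<close>
  have "(norm (v - u))\<^sup>2 \<le> (\<beta> / \<alpha>) * (4 * r * c)\<^sup>2"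
    using order_trans[OF dv obj] \<alpha> by (simp add: field_simps)
  also have "\<dots> = (4 * r * sqrt (\<beta> / \<alpha>) * c)\<^sup>2"
    using \<alpha> by (simp add: power_mult_distrib)
  finally show err: "norm (v - u) \<le> 4 * r * sqrt (\<beta> / \<alpha>) * c"
    by (rule power2_le_imp_le) (use r c \<alpha> in auto)
  \<comment> \<open>Difference of the two multiplier identities. The term
    \<open>g \<bullet> (v - u)\<close> is linear in the error, hence the summand with the first
    power of \<open>c\<close>.\<close>
  have "(m - l) * r\<^sup>2 = (quad_obj f g v - quad_obj f g u) - g \<bullet> (v - u)"
    using sphere_critical_multiplier[OF u] sphere_critical_multiplier[OF crit_v]
    by (simp add: inner_diff algebra_simps)
  then have "\<bar>m - l\<bar> * r\<^sup>2 = \<bar>(quad_obj f g v - quad_obj f g u) - g \<bullet> (v - u)\<bar>"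
    by (metis abs_mult abs_power2)
  also have "\<dots> \<le> (quad_obj f g v - quad_obj f g u) + norm g * norm (v - u)"
    using Cauchy_Schwarz_ineq2[of g "v - u"] nonneg by linarith
  also have "\<dots> \<le> 16 * r\<^sup>2 * \<beta> * c\<^sup>2 + norm g * (4 * r * sqrt (\<beta> / \<alpha>) * c)"
    using obj' err by (intro add_mono mult_left_mono) auto
  finally have "\<bar>m - l\<bar> \<le> (16 * r\<^sup>2 * \<beta> * c\<^sup>2 + norm g * (4 * r * sqrt (\<beta> / \<alpha>) * c)) / r\<^sup>2"
    using r by (simp add: pos_le_divide_eq)
  also have "\<dots> = 16 * \<beta> * c\<^sup>2 + 4 / r * norm g * sqrt (\<beta> / \<alpha>) * c"
    using r by (simp add: add_divide_distrib power2_eq_square)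
  finally show "\<bar>m - l\<bar> \<le> 16 * \<beta> * c\<^sup>2 + 4 / r * norm g * sqrt (\<beta> / \<alpha>) * c" .
qed

section \<open>Extreme eigenvalues as Rayleigh bounds\<close>

text \<open>\<open>E\<close> consists exactly of the eigenvalues of an orthonormal eigenbasis, and a
  Rayleigh quotient is a weighted mean of these.\<close>

lemma eigenvalues_rayleigh:
  fixes S
  defines "E \<equiv> {t. \<exists>z\<in>S. z \<noteq> 0 \<and> f z = t *\<^sub>R z}"
  assumes S: "subspace S" "f ` S \<subseteq> S" and ne: "S \<noteq> {0}"
  shows "finite E" "E \<noteq> {}"
    and "\<And>y. y \<in> S \<Longrightarrow> Min E * (y \<bullet> y) \<le> y \<bullet> f y"
    and "\<And>y. y \<in> S \<Longrightarrow> y \<bullet> f y \<le> Max E * (y \<bullet> y)"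
proof -
  obtain B where B: "finite B" "pairwise orthogonal B" "span B = S"
      "\<And>b. b \<in> B \<Longrightarrow> norm b = 1" "\<And>b. b \<in> B \<Longrightarrow> \<exists>t. f b = t *\<^sub>R b"
    using orthonormal_eigenbasis[OF S] by blast
  define ev where "ev b = b \<bullet> f b" for b
  have ev: "f b = ev b *\<^sub>R b" if b: "b \<in> B" for b
  proof -
    obtain t where t: "f b = t *\<^sub>R b" using B(5)[OF b] by blast
    have "b \<bullet> b = 1" using B(4)[OF b] by (simp add: dot_square_norm)
    then show ?thesis using t by (simp add: ev_def)
  qed
  have parseval: "y \<bullet> y = (\<Sum>b\<in>B. (y \<bullet> b)\<^sup>2)" if "y \<in> S" for y
    using orthonormal_parseval[OF B(1,2,4)] that B(3) by (simp add: dot_square_norm)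
  have "E = ev ` B"
  proof
    show "ev ` B \<subseteq> E"
    proof
      fix t assume "t \<in> ev ` B"
      then obtain b where b: "b \<in> B" "t = ev b" by blast
      have "b \<in> S" using b B(3) span_base by blast
      moreover have "b \<noteq> 0" using B(4)[OF b(1)] by auto
      ultimately show "t \<in> E" unfolding E_def using ev b by blast
    qed
    show "E \<subseteq> ev ` B"
    proof
      fix t assume "t \<in> E"
      then obtain z where z: "z \<in> S" "z \<noteq> 0" "f z = t *\<^sub>R z" by (auto simp: E_def)
      \<comment> \<open>Self-adjointness forces the eigenvalue of \<open>z\<close> to agree with
        that of any basis vector on which \<open>z\<close> has a nonzero coordinate.\<close>
      have "\<exists>b\<in>B. z \<bullet> b \<noteq> 0"
      proof (rule ccontr)
        assume "\<not> (\<exists>b\<in>B. z \<bullet> b \<noteq> 0)"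
        then have "z \<bullet> z = 0" using parseval[OF z(1)] by simp
        then show False using z by simp
      qed
      then obtain b where b: "b \<in> B" "z \<bullet> b \<noteq> 0" by blast
      have "t * (z \<bullet> b) = ev b * (z \<bullet> b)"
        using self_adjoint[of z b] z ev[OF b(1)] by simp
      then show "t \<in> ev ` B" using b by auto
    qed
  qed
  moreover have "B \<noteq> {}" using B(3) ne by auto
  ultimately show fin: "finite E" and "E \<noteq> {}" using B(1) by auto
  have expand: "y \<bullet> f y = (\<Sum>b\<in>B. (y \<bullet> b)\<^sup>2 * ev b)" if "y \<in> S" for y
  proof -
    have "y \<bullet> f y = (\<Sum>b\<in>B. (y \<bullet> b) *\<^sub>R b) \<bullet> f y"
      using orthonormal_basis_expand[OF B(2,4) _ B(1), of y] that B(3) by simp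
    also have "\<dots> = (\<Sum>b\<in>B. (y \<bullet> b)\<^sup>2 * ev b)"
      unfolding inner_sum_left
      by (rule sum.cong) (auto simp: ev self_adjoint[symmetric] power2_eq_square inner_commute)
    finally show ?thesis .
  qed
  have bounds: "Min E \<le> ev b" "ev b \<le> Max E" if "b \<in> B" for b
    using that fin \<open>E = ev ` B\<close> by auto
  fix y assume y: "y \<in> S"
  show "Min E * (y \<bullet> y) \<le> y \<bullet> f y"
    unfolding parseval[OF y] expand[OF y] sum_distrib_left
    by (rule sum_mono) (simp add: bounds mult.commute[of _ "ev _"] mult_right_mono)
  show "y \<bullet> f y \<le> Max E * (y \<bullet> y)"
    unfolding parseval[OF y] expand[OF y] sum_distrib_left
    by (rule sum_mono) (simp add: bounds mult.commute[of _ "ev _"] mult_right_mono)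
qed

end

section \<open>The Lanczos process\<close>

lemma matrix_self_adjoint_operator:
  fixes M :: "real^'n^'n"
  assumes "\<And>x y. (M *v x) \<bullet> y = x \<bullet> (M *v y)"
  shows "self_adjoint_operator ((*v) M)"
  by (rule self_adjoint_operator.intro) (use assms in auto)

text \<open>The Lanczos vectors span by definition; what later arguments use of powers of
  \<open>M\<close> is only that \<open>M\<close> raises the index by one and that \<open>r\<close>
  lies in the first space.\<close>

definition krylov :: "real^'n^'n \<Rightarrow> real^'n \<Rightarrow> nat \<Rightarrow> (real^'n) set" where
  "krylov M r k = span ((\<lambda>i. lq M r (Suc i)) ` {..<k})"

text \<open>The case \<open>j = 0\<close> is separate because truncated subtraction makes
  \<open>lq M r 0\<close> equal to \<open>q_1\<close>, while the process starts with
  \<open>q_0 = 0\<close>.\<close>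

lemma lanc_components:
  "lanc M r j = ((if j = 0 then 0 else lq M r j), lq M r (Suc j), lbeta M r (Suc j))"
  by (cases j) (auto simp: lq_def lbeta_def Let_def split: prod.split)

text \<open>If \<open>w j\<close> vanishes, so does the coefficient \<open>lbeta\<close>, and the
  product form still holds. The three-term recurrence is thus valid at every index, also after
  breakdown.\<close>

lemma lanczos_residual:
  fixes M :: "real^'n^'n" and r :: "real^'n"
  defines "w \<equiv> \<lambda>j. M *v lq M r (Suc j) - lalpha M r (Suc j) *\<^sub>R lq M r (Suc j)
    - lbeta M r (Suc j) *\<^sub>R (if j = 0 then 0 else lq M r j)"
  shows "lbeta M r (Suc (Suc j)) = norm (w j)"
    and "lbeta M r (Suc (Suc j)) *\<^sub>R lq M r (Suc (Suc j)) = w j"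
proof -
  have "lanc M r (Suc j) =
      (lq M r (Suc j), if norm (w j) > 0 then (1 / norm (w j)) *\<^sub>R w j else 0, norm (w j))"
    by (simp only: lanc.simps(2) lanc_components[of M r j] Let_def prod.case w_def lalpha_def)
  from trans[OF sym[OF lanc_components] this]
  have "lq M r (Suc (Suc j)) = (if norm (w j) > 0 then (1 / norm (w j)) *\<^sub>R w j else 0)"
    and *: "lbeta M r (Suc (Suc j)) = norm (w j)"
    by (simp_all only: prod.inject)
  then show "lbeta M r (Suc (Suc j)) *\<^sub>R lq M r (Suc (Suc j)) = w j" by auto
  show "lbeta M r (Suc (Suc j)) = norm (w j)" by (rule *)
qed

lemma lanczos_recurrence:
  "M *v lq M r (Suc j) = lbeta M r (Suc (Suc j)) *\<^sub>R lq M r (Suc (Suc j))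
    + lalpha M r (Suc j) *\<^sub>R lq M r (Suc j)
    + lbeta M r (Suc j) *\<^sub>R (if j = 0 then 0 else lq M r j)"
  using lanczos_residual(2)[of M r j] by (simp add: algebra_simps)

lemma lq_1: "lq M r (Suc 0) = (1 / norm r) *\<^sub>R r"
  by (simp add: lq_def)

text \<open>An earlier zero would contradict the minimality of \<open>kmax\<close>; the first
  coefficient is \<open>norm r\<close>.\<close>

lemma lbeta_nonzero:
  assumes "r \<noteq> 0" "1 \<le> j" "j \<le> kmax M r"
  shows "lbeta M r j \<noteq> 0"
proof (cases "j = 1")
  case True
  then show ?thesis using assms by (simp add: lbeta_def)
next
  case False
  then have "j - 1 < kmax M r" "1 \<le> j - 1" using assms by auto
  then show ?thesis
    using not_less_Least[of "j - 1" "\<lambda>k. 1 \<le> k \<and> lbeta M r (k + 1) = 0"] assms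
    by (simp add: kmax_def)
qed

text \<open>The choice of \<open>lalpha\<close> gives orthogonality to the last vector, and
  self-adjointness of \<open>M\<close> with the recurrence gives it for all earlier ones.\<close>

lemma lanczos_orthonormal:
  fixes M :: "real^'n^'n"
  assumes sa: "\<And>x y. (M *v x) \<bullet> y = x \<bullet> (M *v y)" and r: "r \<noteq> 0"
    and k: "k \<le> kmax M r" and ij: "i < k" "j < k"
  shows "lq M r (Suc i) \<bullet> lq M r (Suc j) = (if i = j then 1 else 0)"
  using k ij
proof (induction k arbitrary: i j)
  case (Suc k)
  define q where "q i = lq M r (Suc i)" for i
  define \<beta> where "\<beta> i = lbeta M r (Suc i)" for i
  have IH: "q i \<bullet> q j = (if i = j then 1 else 0)" if "i < k" "j < k" for i j
    using Suc that by (simp add: q_def)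
  have rec: "M *v q j = \<beta> (Suc j) *\<^sub>R q (Suc j) + lalpha M r (Suc j) *\<^sub>R q j
      + \<beta> j *\<^sub>R (if j = 0 then 0 else q (j - 1))" for j
    using lanczos_recurrence[of M r j] by (cases j) (simp_all add: q_def \<beta>_def)
  have "q k \<bullet> q k = 1 \<and> (\<forall>j<k. q k \<bullet> q j = 0)"
  proof (cases k)
    case 0
    then show ?thesis using r by (simp add: q_def lq_1 dot_square_norm power2_eq_square)
  next
    case (Suc m)
    have nz: "\<beta> k \<noteq> 0" unfolding \<beta>_def using r Suc.prems by (intro lbeta_nonzero) auto
    define w where "w = \<beta> k *\<^sub>R q k"
    have w: "w = M *v q m - lalpha M r (Suc m) *\<^sub>R q m - \<beta> m *\<^sub>R (if m = 0 then 0 else q (m - 1))"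
      using rec[of m] Suc by (simp add: w_def)
    have bw: "\<beta> k = norm w"
      using lanczos_residual[of M r m] Suc by (simp add: w_def q_def \<beta>_def)
    then have "0 < \<beta> k" using nz norm_ge_zero[of w] by linarith
    then have "norm w = \<beta> k * norm (q k)" by (simp add: w_def)
    then have "\<beta> k * norm (q k) = \<beta> k * 1" unfolding bw[symmetric] mult_1_right by (rule sym)
    then have "norm (q k) = 1" using nz unfolding mult_left_cancel[OF nz] by simp
    then have "q k \<bullet> q k = 1" by (simp add: dot_square_norm)
    moreover have "w \<bullet> q j = 0" if j: "j < k" for j
    proof (cases "j = m")
      case True
      have "(M *v q m) \<bullet> q m = lalpha M r (Suc m)"
        by (simp add: lalpha_def q_def inner_commute)
      moreover have "(if m = 0 then 0 else q (m - 1)) \<bullet> q m = 0"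
        using IH[of "m - 1" m] Suc by auto
      ultimately show ?thesis
        using True IH[of m m] Suc by (simp add: w inner_diff_left)
    next
      case False
      then have jm: "j < m" using j Suc by simp
      \<comment> \<open>Moved onto \<open>q j\<close>, the matrix reaches no further than
        \<open>q (Suc j)\<close>. Only \<open>Suc j = m\<close> contributes, and precisely this term
        is subtracted in \<open>w\<close>.\<close>
      have "(M *v q m) \<bullet> q j = q m \<bullet> (M *v q j)" by (rule sa)
      also have "\<dots> = (if Suc j = m then \<beta> m else 0)"
        unfolding rec[of j] using IH[of m "Suc j"] IH[of m j] IH[of m "j - 1"] jm Suc
        by (auto simp: inner_add_right)
      finally have "(M *v q m) \<bullet> q j = (if Suc j = m then \<beta> m else 0)" .
      moreover have "(if m = 0 then 0 else q (m - 1)) \<bullet> q j = (if Suc j = m then 1 else 0)"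
        using IH[of "m - 1" j] jm Suc by auto
      ultimately show ?thesis
        using jm IH[of m j] Suc by (simp add: w inner_diff_left)
    qed
    ultimately show ?thesis using nz by (auto simp: w_def)
  qed
  then have "q i \<bullet> q j = (if i = j then 1 else 0)"
    using Suc.prems IH[of i j] by (auto simp: less_Suc_eq inner_commute)
  then show ?case by (simp add: q_def)
qed simp

text \<open>Identifies the explicit tridiagonal array with the compression of \<open>M\<close> to
  the Lanczos basis; one triangle comes from the recurrence, the other from symmetry.\<close>

lemma Tk_eq_inner:
  fixes M :: "real^'n^'n"
  assumes sa: "\<And>x y. (M *v x) \<bullet> y = x \<bullet> (M *v y)" and r: "r \<noteq> 0"
    and k: "k \<le> kmax M r" and ij: "i < k" "j < k"
  shows "Tk M r k i j = lq M r (Suc i) \<bullet> (M *v lq M r (Suc j))"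
proof -
  note on = lanczos_orthonormal[OF sa r k]
  have upper: "lq M r (Suc j) \<bullet> (M *v lq M r (Suc i)) = (if j = Suc i then lbeta M r (Suc j) else 0)"
    if "i < j" "j < k" for i j
    unfolding lanczos_recurrence[of M r i]
    using on[of j "Suc i"] on[of j i] on[of j "i - 1"] that
    by (auto simp: inner_add_right split: if_splits)
  consider "i < j" | "i = j" | "j < i" by linarith
  then show ?thesis
  proof cases
    case 1
    then show ?thesis
      using upper[OF 1 ij(2)] ij sa[of "lq M r (Suc i)" "lq M r (Suc j)"]
      by (auto simp: Tk_def inner_commute)
  next
    case 2
    then show ?thesis using ij by (simp add: Tk_def lalpha_def)
  next
    case 3
    then show ?thesis using upper[OF 3 ij(1)] ij by (auto simp: Tk_def)
  qed
qed

section \<open>Krylov spaces of the Lanczos process\<close>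

lemma subspace_krylov: "subspace (krylov M r k)"
  by (simp add: krylov_def)

lemma krylov_mono_Suc: "krylov M r k \<subseteq> krylov M r (Suc k)"
  unfolding krylov_def by (intro span_mono image_mono) auto

lemma lq_in_krylov: "i < k \<Longrightarrow> lq M r (Suc i) \<in> krylov M r k"
  unfolding krylov_def by (intro span_base) auto

lemma start_in_krylov: "r \<in> krylov M r 1"
proof (cases "r = 0")
  case False
  have "norm r *\<^sub>R lq M r (Suc 0) \<in> krylov M r 1"
    by (intro subspace_scale[OF subspace_krylov] lq_in_krylov) simp
  then show ?thesis using False by (simp add: lq_1)
qed (simp add: subspace_0 subspace_krylov)

lemma krylov_image: "(*v) M ` krylov M r k \<subseteq> krylov M r (Suc k)"
proof -
  have "M *v lq M r (Suc i) \<in> krylov M r (Suc k)" if "i < k" for i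
  proof -
    have "(if i = 0 then 0 else lq M r i) \<in> krylov M r (Suc k)"
      using that lq_in_krylov[of "i - 1" "Suc k" M r]
      by (auto simp: subspace_0[OF subspace_krylov])
    then show ?thesis
      unfolding lanczos_recurrence[of M r i] using that
      by (intro subspace_add subspace_scale subspace_krylov lq_in_krylov) auto
  qed
  then have "(*v) M ` ((\<lambda>i. lq M r (Suc i)) ` {..<k}) \<subseteq> krylov M r (Suc k)" by auto
  then have "span ((*v) M ` ((\<lambda>i. lq M r (Suc i)) ` {..<k})) \<subseteq> krylov M r (Suc k)"
    by (rule span_minimal) (rule subspace_krylov)
  then show ?thesis
    by (simp add: krylov_def linear_span_image)
qed

lemma krylov_subset_invariant:
  assumes S: "subspace S" "(*v) M ` S \<subseteq> S" "r \<in> S"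
  shows "krylov M r k \<subseteq> S"
proof -
  have MS: "M *v y \<in> S" if "y \<in> S" for y using S(2) that by blast
  have "fst (lanc M r j) \<in> S \<and> fst (snd (lanc M r j)) \<in> S" for j
  proof (induction j)
    case 0
    then show ?case using S by (auto simp: subspace_0 subspace_scale)
  next
    case (Suc j)
    obtain p q c where "lanc M r j = (p, q, c)" by (cases "lanc M r j")
    then show ?case
      using Suc S(1) by (auto simp: Let_def subspace_0 subspace_scale subspace_diff MS)
  qed
  then show ?thesis
    unfolding krylov_def by (intro span_minimal S) (auto simp: lq_def)
qed

lemma mat_mult_vector: "mat l *v (x :: real^'n) = l *\<^sub>R x"
proof -
  have "mat l = l *\<^sub>R (mat 1 :: real^'n^'n)"
    by (simp add: mat_def vec_eq_iff)
  then show ?thesis by (simp add: scaleR_matrix_vector_assoc[symmetric])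
qed

lemma inner_matrix_vector_transpose:
  fixes B :: "real^'m^'n"
  shows "(B *v y) \<bullet> z = y \<bullet> (transpose B *v z)"
  by (metis dot_lmul_matrix inner_commute transpose_matrix_vector)

section \<open>The reduced problem in Lanczos coordinates\<close>

lemma krylov_expand:
  fixes M :: "real^'n^'n"
  assumes sa: "\<And>x y. (M *v x) \<bullet> y = x \<bullet> (M *v y)" and r: "r \<noteq> 0"
    and k: "k \<le> kmax M r" and u: "u \<in> krylov M r k"
  shows "(\<Sum>j<k. (u \<bullet> lq M r (Suc j)) *\<^sub>R lq M r (Suc j)) = u"
proof -
  let ?q = "\<lambda>j. lq M r (Suc j)"
  note on = lanczos_orthonormal[OF sa r k]
  have inj: "inj_on ?q {..<k}"
  proof (rule inj_onI)
    fix i j assume "i \<in> {..<k}" "j \<in> {..<k}" "?q i = ?q j"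
    then show "i = j" using on[of i j] on[of i i] by (auto split: if_splits)
  qed
  have "(\<Sum>b\<in>?q ` {..<k}. (u \<bullet> b) *\<^sub>R b) = u"
  proof (rule orthonormal_basis_expand)
    show "pairwise orthogonal (?q ` {..<k})"
      using on by (auto simp: pairwise_def orthogonal_def split: if_splits)
    show "norm b = 1" if "b \<in> ?q ` {..<k}" for b
      using that on by (auto simp: norm_eq_1)
  qed (use u in \<open>auto simp: krylov_def\<close>)
  then show ?thesis by (simp add: sum.reindex[OF inj] o_def)
qed

text \<open>Testing the Galerkin condition on the Lanczos vectors gives the rows of the tridiagonal
  system: \<open>r\<close> is \<open>norm r\<close> times the first vector, and orthonormality
  preserves the norm.\<close>

lemma rLG_feasible_iff_sphere_critical:
  fixes A :: "real^'n^'n" and C :: "real^'m^'n" and b :: "real^'m"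
  defines "M \<equiv> Pr C ** A ** Pr C" and "r \<equiv> b0 A C b"
  defines "comb \<equiv> \<lambda>k x. \<Sum>j<k. x j *\<^sub>R lq M r (Suc j)"
  assumes sa: "\<And>x y. (M *v x) \<bullet> y = x \<bullet> (M *v y)" and r: "r \<noteq> 0"
    and k: "1 \<le> k" "k \<le> kmax M r"
  shows "rLG_feasible A C b k m x \<longleftrightarrow>
    (\<forall>i\<ge>k. x i = 0) \<and> sphere_critical ((*v) M) r (krylov M r k) (gam C b) m (comb k x)"
proof -
  let ?q = "\<lambda>j. lq M r (Suc j)"
  let ?u = "comb k x"
  note on = lanczos_orthonormal[OF sa r k(2)]
  have q_u: "?q i \<bullet> ?u = x i" if "i < k" for i
  proof -
    have "?q i \<bullet> ?u = (\<Sum>j<k. if i = j then x j else 0)"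
      unfolding comb_def inner_sum_right by (rule sum.cong) (use on that in auto)
    then show ?thesis using that by (simp add: sum.delta)
  qed
  have q_Mu: "?q i \<bullet> (M *v ?u) = (\<Sum>j<k. Tk M r k i j * x j)" if "i < k" for i
  proof -
    have "M *v ?u = (\<Sum>j<k. x j *\<^sub>R (M *v ?q j))"
      unfolding comb_def by (simp add: linear_sum[OF matrix_vector_mul_linear] matrix_vector_mult_scaleR)
    then show ?thesis
      unfolding inner_sum_right
      by (simp add: inner_sum_right) (rule sum.cong, auto simp: Tk_eq_inner[OF sa r k(2) that])
  qed
  have q_r: "?q i \<bullet> r = norm r * (if i = 0 then 1 else 0)" if "i < k" for i
  proof -
    have "r = norm r *\<^sub>R ?q 0" using r by (simp add: lq_1)
    then have "?q i \<bullet> r = norm r * (?q i \<bullet> ?q 0)" by (metis inner_scaleR_right)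
    then show ?thesis using on[of i 0] that by auto
  qed
  have norm_u: "norm ?u = sqrt (\<Sum>i<k. (x i)\<^sup>2)"
  proof -
    have "?u \<bullet> ?u = (\<Sum>i<k. x i * (?q i \<bullet> ?u))"
      by (subst (1) comb_def) (simp add: inner_sum_left)
    also have "\<dots> = (\<Sum>i<k. (x i)\<^sup>2)"
      by (rule sum.cong) (auto simp: q_u power2_eq_square)
    finally show ?thesis by (simp add: norm_eq_sqrt_inner)
  qed
  have uK: "?u \<in> krylov M r k"
    unfolding comb_def
    by (intro subspace_sum subspace_scale subspace_krylov lq_in_krylov) auto
  let ?z = "M *v ?u + r - m *\<^sub>R ?u"
  have "(\<forall>d\<in>krylov M r k. d \<bullet> ?z = 0) \<longleftrightarrow> (\<forall>i<k. ?q i \<bullet> ?z = 0)"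
  proof
    assume *: "\<forall>i<k. ?q i \<bullet> ?z = 0"
    have "subspace {d. d \<bullet> ?z = 0}"
      by (auto simp: subspace_def inner_add_left)
    then have "krylov M r k \<subseteq> {d. d \<bullet> ?z = 0}"
      unfolding krylov_def using * by (intro span_minimal) auto
    then show "\<forall>d\<in>krylov M r k. d \<bullet> ?z = 0" by blast
  qed (auto intro: lq_in_krylov)
  also have "\<dots> \<longleftrightarrow> (\<forall>i<k. (\<Sum>j<k. Tk M r k i j * x j) - m * x i = - norm r * (if i = 0 then 1 else 0))"
    by (auto simp: inner_diff_right inner_add_right q_u q_Mu q_r)
  finally show ?thesis
    using uK norm_u
    by (auto simp: rLG_feasible_def sphere_critical_def Let_def M_def[symmetric] r_def[symmetric])
qed

text \<open>Every critical vector in the Krylov space has Lanczos coordinates, so minimality among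
  coordinate vectors is minimality among all critical pairs.\<close>

lemma rLG_minimizer_min_critical:
  fixes A :: "real^'n^'n" and C :: "real^'m^'n" and b :: "real^'m"
  defines "M \<equiv> Pr C ** A ** Pr C" and "r \<equiv> b0 A C b"
  assumes sa: "\<And>x y. (M *v x) \<bullet> y = x \<bullet> (M *v y)" and r: "r \<noteq> 0"
    and k: "1 \<le> k" "k \<le> kmax M r" and min: "rLG_minimizer A C b k m x"
  shows "min_critical ((*v) M) r (krylov M r k) (gam C b) m (\<Sum>j<k. x j *\<^sub>R lq M r (Suc j))"
proof -
  note iff = rLG_feasible_iff_sphere_critical[of C A b k, folded M_def r_def, OF sa r k]
  have "m \<le> m'" if "sphere_critical ((*v) M) r (krylov M r k) (gam C b) m' u'" for m' u'
  proof -
    define x' where "x' j = (if j < k then u' \<bullet> lq M r (Suc j) else 0)" for j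
    have "u' \<in> krylov M r k" using that by (simp add: sphere_critical_def)
    then have "(\<Sum>j<k. x' j *\<^sub>R lq M r (Suc j)) = u'"
      using krylov_expand[OF sa r k(2)] by (simp add: x'_def)
    then have "rLG_feasible A C b k m' x'"
      using that unfolding iff by (simp add: x'_def)
    then show ?thesis using min unfolding rLG_minimizer_def by blast
  qed
  then show ?thesis
    using min unfolding rLG_minimizer_def min_critical_def iff by blast
qed

section \<open>The constrained Rayleigh quotient problem\<close>

definition null_space :: "real^'m^'n \<Rightarrow> (real^'n) set" where
  "null_space C = {z. transpose C *v z = 0}"

lemma subspace_null_space: "subspace (null_space C)"
  unfolding null_space_def
  by (rule linear_subspace_kernel) (rule matrix_vector_mul_linear)

locale crq_problem =
  fixes A :: "real^'n^'n" and C :: "real^'m^'n" and b :: "real^'m"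
  assumes symA: "transpose A = A"
    and rankC: "rank C = CARD('m)"
    and n0_small: "norm (n0 C b) < 1"
    and b0_nz: "b0 A C b \<noteq> 0"
begin

abbreviation "G \<equiv> transpose C ** C"
abbreviation "N \<equiv> null_space C"
abbreviation "M \<equiv> Pr C ** A ** Pr C"
abbreviation "g \<equiv> b0 A C b"
abbreviation "\<gamma> \<equiv> gam C b"

text \<open>Since \<open>x \<bullet> (G *v x)\<close> is the squared norm of \<open>C *v x\<close>,
  full column rank makes \<open>G\<close> injective, and \<open>matrix_inv G\<close> is a genuine
  inverse.\<close>

lemma gram_inverse: "transpose C *v (C *v (matrix_inv G *v y)) = y"
proof -
  have "x = 0" if "G *v x = 0" for x
  proof -
    have "(C *v x) \<bullet> (C *v x) = x \<bullet> (G *v x)"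
      by (simp add: inner_matrix_vector_transpose matrix_vector_mul_assoc del: transpose_matrix_vector)
    then have "C *v x = C *v 0" using that by simp
    then show "x = 0" using rankC full_rank_injective[of C] by (metis injD)
  qed
  then obtain B where "B ** G = mat 1" using matrix_left_invertible_ker by blast
  then have "invertible G" using invertible_left_inverse by blast
  then have "G ** matrix_inv G = mat 1"
    unfolding invertible_def matrix_inv_def by (rule someI2_ex) auto
  then show ?thesis
    by (simp add: matrix_vector_mul_assoc matrix_mul_assoc del: transpose_matrix_vector)
qed

lemma Pr_apply: "Pr C *v y = y - C *v (matrix_inv G *v (transpose C *v y))"
  by (simp add: Pr_def matrix_vector_mult_diff_rdistrib matrix_vector_mul_assoc matrix_mul_assoc
      del: transpose_matrix_vector)

lemma range_orthogonal: "z \<in> N \<Longrightarrow> (C *v y) \<bullet> z = 0"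
  by (simp add: null_space_def inner_matrix_vector_transpose del: transpose_matrix_vector)

lemma Pr_in_null_space: "Pr C *v y \<in> N"
  by (simp add: null_space_def Pr_apply matrix_vector_mult_diff_distrib gram_inverse
      del: transpose_matrix_vector)

lemma Pr_id: "y \<in> N \<Longrightarrow> Pr C *v y = y"
  by (simp add: null_space_def Pr_apply del: transpose_matrix_vector)

lemma inner_Pr: "z \<in> N \<Longrightarrow> (Pr C *v y) \<bullet> z = y \<bullet> z"
  by (simp add: Pr_apply inner_diff_left range_orthogonal)

text \<open>Both sides equal the inner product of the two projections, which avoids transposing the
  Gram inverse.\<close>

lemma Pr_self_adjoint: "(Pr C *v x) \<bullet> y = x \<bullet> (Pr C *v y)"
  using inner_Pr[OF Pr_in_null_space, of x y] inner_Pr[OF Pr_in_null_space, of y x]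
  by (simp add: inner_commute)

lemma A_self_adjoint: "(A *v x) \<bullet> y = x \<bullet> (A *v y)"
  using inner_matrix_vector_transpose[of A x y] by (simp only: symA)

lemma M_apply: "M *v x = Pr C *v (A *v (Pr C *v x))"
  by (simp add: matrix_vector_mul_assoc matrix_mul_assoc)

lemma M_self_adjoint: "(M *v x) \<bullet> y = x \<bullet> (M *v y)"
  by (simp add: M_apply Pr_self_adjoint A_self_adjoint)

sublocale M: self_adjoint_operator "(*v) M"
  by (rule matrix_self_adjoint_operator) (rule M_self_adjoint)

lemma M_image: "(*v) M ` N \<subseteq> N"
  using Pr_in_null_space by (auto simp: M_apply)

lemma g_in_null_space: "g \<in> N"
  by (simp add: b0_def Pr_in_null_space)

lemma n0_orthogonal: "z \<in> N \<Longrightarrow> n0 C b \<bullet> z = 0"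
  by (simp add: n0_def range_orthogonal)

lemma gam_pos: "0 < \<gamma>"
  using n0_small by (simp add: gam_def abs_square_less_1)

lemma gam_sq: "\<gamma>\<^sup>2 = 1 - (norm (n0 C b))\<^sup>2"
  using n0_small by (simp add: gam_def abs_square_le_1)

section \<open>CRQopt and LGopt as sphere problems in the null space\<close>

text \<open>On \<open>N\<close> the forms of \<open>A\<close> and \<open>M\<close> agree, and the
  cross term with \<open>n0 C b\<close> sees only its projection \<open>g\<close>. Up to a constant,
  \<open>hq\<close> is \<open>quad_obj\<close>.\<close>

lemma hq_n0_add:
  assumes "w \<in> N"
  shows "hq A (n0 C b + w) = hq A (n0 C b) + quad_obj ((*v) M) g w"
proof -
  have "w \<bullet> (M *v w) = w \<bullet> (A *v w)"
    using assms by (simp add: M_apply Pr_id Pr_self_adjoint[symmetric])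
  moreover have "g \<bullet> w = w \<bullet> (A *v n0 C b)"
    unfolding b0_def inner_Pr[OF assms] by (rule inner_commute)
  moreover have "n0 C b \<bullet> (A *v w) = w \<bullet> (A *v n0 C b)"
    using A_self_adjoint[of w "n0 C b"] by (simp add: inner_commute)
  ultimately show ?thesis
    by (simp add: hq_def quad_obj_def matrix_vector_right_distrib inner_add)
qed

text \<open>Pythagoras: \<open>n0 C b\<close> solves the linear constraint and is orthogonal to
  \<open>N\<close>, which leaves radius \<gamma> for the remainder.\<close>

lemma CRQ_feasible_iff: "CRQ_feasible C b v \<longleftrightarrow> v - n0 C b \<in> N \<and> norm (v - n0 C b) = \<gamma>"
proof -
  define w where "w = v - n0 C b"
  have v: "v = n0 C b + w" by (simp add: w_def)
  have "transpose C *v v = b \<longleftrightarrow> w \<in> N"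
    by (simp add: v null_space_def matrix_vector_right_distrib n0_def gram_inverse
        del: transpose_matrix_vector)
  moreover have "v \<bullet> v = 1 \<longleftrightarrow> norm w = \<gamma>" if "w \<in> N"
  proof -
    have "v \<bullet> v = (norm (n0 C b))\<^sup>2 + (norm w)\<^sup>2"
      using n0_orthogonal[OF that] 
      by (simp only: v inner_add power2_norm_eq_inner) (simp add: inner_commute)
    then have "v \<bullet> v = 1 \<longleftrightarrow> (norm w)\<^sup>2 = \<gamma>\<^sup>2" using gam_sq by auto
    then show ?thesis using gam_pos by (simp add: power2_eq_iff_nonneg)
  qed
  ultimately show ?thesis unfolding CRQ_feasible_def w_def[symmetric] by blast
qed

text \<open>\<open>N\<close> is invariant and contains \<open>g\<close>, so the residual lies in
  \<open>N\<close>; it is orthogonal to \<open>N\<close> only if it vanishes.\<close>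

lemma LG_feasible_iff: "LG_feasible A C b l u \<longleftrightarrow> sphere_critical ((*v) M) g N \<gamma> l u"
proof -
  let ?z = "M *v u + g - l *\<^sub>R u"
  have "(M - mat l) *v u = - g \<longleftrightarrow> ?z = 0"
    by (simp add: matrix_vector_mult_diff_rdistrib mat_mult_vector eq_neg_iff_add_eq_0 algebra_simps)
  moreover have "?z = 0 \<longleftrightarrow> (\<forall>d\<in>N. d \<bullet> ?z = 0)" if "u \<in> N"
  proof
    have "?z \<in> N"
      using that M_image g_in_null_space
      by (intro subspace_diff subspace_add subspace_scale subspace_null_space) auto
    moreover assume "\<forall>d\<in>N. d \<bullet> ?z = 0"
    ultimately have "?z \<bullet> ?z = 0" by blast
    then show "?z = 0" by (simp only: inner_eq_zero_iff)
  qed simp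
  moreover have "transpose C *v u = 0 \<longleftrightarrow> u \<in> N" by (simp add: null_space_def)
  ultimately show ?thesis unfolding LG_feasible_def sphere_critical_def by blast
qed

lemma LG_minimizer_iff: "LG_minimizer A C b l u \<longleftrightarrow> min_critical ((*v) M) g N \<gamma> l u"
  by (simp add: LG_minimizer_def min_critical_def LG_feasible_iff)

text \<open>A QEP-feasible pair with multiplier below the spectrum of \<open>M\<close> on \<open>N\<close> rescales to an
  LG-feasible one, hence an LG minimum at the bottom \<open>\<theta>\<close> of the spectrum makes the
  corresponding eigenvector, which is orthogonal to \<open>g\<close>, a QEP minimizer.\<close>
lemma easy_case_multiplier_less:
  assumes easy: "QEP_easy_case A C b" and LG: "LG_minimizer A C b l u"
    and lo: "\<And>y. y \<in> N \<Longrightarrow> \<theta> * (y \<bullet> y) \<le> y \<bullet> (M *v y)"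
    and z: "z \<in> N" "z \<noteq> 0" "M *v z = \<theta> *\<^sub>R z"
  shows "l < \<theta>"
proof -
  have crit: "min_critical ((*v) M) g N \<gamma> l u" using LG LG_minimizer_iff by blast
  have "l * (z \<bullet> z) \<le> \<theta> * (z \<bullet> z)"
    using M.min_critical_psd[OF subspace_null_space gam_pos crit z(1)] z by simp
  then have "l \<le> \<theta>" using z by simp
  moreover have "l \<noteq> \<theta>"
  proof
    assume l: "l = \<theta>"
    have shift: "(M - mat t) *v y = M *v y - t *\<^sub>R y" for t y
      by (simp add: matrix_vector_mult_diff_rdistrib mat_mult_vector)
    have sa: "((M - mat t) *v x) \<bullet> y = x \<bullet> ((M - mat t) *v y)" for t x y
      by (simp add: shift inner_diff M_self_adjoint)
    have "(M - mat \<theta>) *v u = - g" using LG l by (simp add: LG_minimizer_def LG_feasible_def)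
    \<comment> \<open>\<open>g\<close> is in the range of the self-adjoint
      \<open>M - mat \<theta>\<close>, hence orthogonal to its kernel vector
      \<open>z\<close>.\<close>
    then have "g \<bullet> z = - (u \<bullet> ((M - mat \<theta>) *v z))"
      using sa[of \<theta> u z] by simp
    then have gz: "g \<bullet> z = 0" using z by (simp add: shift)
    have "QEP_feasible A C b \<theta> z"
      using z gz by (simp add: QEP_feasible_def shift null_space_def)
    moreover have "\<theta> \<le> l'" if Q: "QEP_feasible A C b l' z'" for l' z'
    proof (rule ccontr)
      assume "\<not> \<theta> \<le> l'"
      then have l': "l' < \<theta>" by simp
      define y where "y = (M - mat l') *v z'"
      define c where "c = g \<bullet> z'"
      have z': "z' \<noteq> 0" "z' \<in> N" and y: "(M - mat l') *v y = (inverse (\<gamma>\<^sup>2) * c) *\<^sub>R g"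
        using Q by (auto simp: QEP_feasible_def null_space_def y_def c_def)
      \<comment> \<open>The quadratic eigenvalue equation paired with \<open>z'\<close>. If
        \<open>c\<close> were 0, then \<open>y = 0\<close> and \<open>l'\<close> would be a Rayleigh
        quotient below \<theta>.\<close>
      have yy: "y \<bullet> y = inverse (\<gamma>\<^sup>2) * c\<^sup>2"
        using sa[of l' z' y] y by (simp add: y_def c_def inner_commute power2_eq_square)
      have "c \<noteq> 0"
      proof
        assume "c = 0"
        then have "y = 0" using yy by simp
        then have "l' * (z' \<bullet> z') = z' \<bullet> (M *v z')" by (simp add: y_def shift)
        then have "\<theta> * (z' \<bullet> z') \<le> l' * (z' \<bullet> z')" using lo[OF z'(2)] by simp
        then show False using l' z' by simp
      qed
      \<comment> \<open>The factor turns the right-hand side into \<open>- g\<close>, and by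
        \<open>yy\<close> it also gives norm \<gamma>.\<close>
      define u' where "u' = (- (\<gamma>\<^sup>2 / c)) *\<^sub>R y"
      have "(M - mat l') *v u' = (- (\<gamma>\<^sup>2 / c)) *\<^sub>R ((M - mat l') *v y)"
        unfolding u'_def by (rule matrix_vector_mult_scaleR)
      then have "(M - mat l') *v u' = - g"
        using \<open>c \<noteq> 0\<close> gam_pos unfolding y by simp
      moreover have "norm u' = \<gamma>"
      proof -
        have "u' \<bullet> u' = \<gamma>\<^sup>2"
          using yy \<open>c \<noteq> 0\<close> gam_pos by (simp add: u'_def field_simps power2_eq_square)
        then show ?thesis using gam_pos by (simp add: norm_eq_sqrt_inner)
      qed
      moreover have "u' \<in> N"
        using z' M_image unfolding u'_def y_def shift
        by (intro subspace_diff subspace_scale subspace_null_space) auto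
      ultimately have "LG_feasible A C b l' u'" by (simp add: LG_feasible_def null_space_def)
      then show False using LG l l' by (force simp: LG_minimizer_def)
    qed
    ultimately have "QEP_hard_case A C b"
      using gz unfolding QEP_hard_case_def QEP_minimizer_def by blast
    then show False using easy by (simp add: QEP_easy_case_def)
  qed
  ultimately show ?thesis by simp
qed

text \<open>The gap \<open>\<theta> - l\<close> makes the form of \<open>M - l\<close> positive
  definite on \<open>N\<close>, so a vector on the sphere with no larger objective than
  \<open>u\<close> must be \<open>u\<close>.\<close>

lemma CRQ_minimizer_eq:
  assumes "CRQ_minimizer A C b v" and LG: "LG_minimizer A C b l u" and "l < \<theta>"
    and lo: "\<And>y. y \<in> N \<Longrightarrow> \<theta> * (y \<bullet> y) \<le> y \<bullet> (M *v y)"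
  shows "v = n0 C b + u"
proof -
  define w where "w = v - n0 C b"
  have w: "w \<in> N" "norm w = \<gamma>" and v: "v = n0 C b + w"
    using assms by (auto simp: CRQ_minimizer_def CRQ_feasible_iff w_def)
  have crit: "sphere_critical ((*v) M) g N \<gamma> l u"
    using LG by (simp add: LG_minimizer_iff min_critical_def)
  then have u: "u \<in> N" "norm u = \<gamma>" by (auto simp: sphere_critical_def)
  then have "hq A v \<le> hq A (n0 C b + u)"
    using assms by (auto simp: CRQ_minimizer_def CRQ_feasible_iff)
  then have "quad_obj ((*v) M) g w - quad_obj ((*v) M) g u \<le> 0"
    using hq_n0_add w u by (simp add: v)
  then have "(w - u) \<bullet> (M *v (w - u)) - l * ((w - u) \<bullet> (w - u)) \<le> 0"
    using M.quad_obj_diff[OF subspace_null_space crit w] by (simp add: inner_diff_right)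
  then have "(\<theta> - l) * ((w - u) \<bullet> (w - u)) \<le> 0"
    using lo[of "w - u"] subspace_diff[OF subspace_null_space w(1) u(1)]
    by (simp add: left_diff_distrib)
  then have "(w - u) \<bullet> (w - u) \<le> 0" using \<open>l < \<theta>\<close> by (simp add: mult_le_0_iff)
  then have "w - u = 0" using inner_gt_zero_iff[of "w - u"] by linarith
  then show ?thesis using v by simp
qed

section \<open>Coordinates of the null space and the compressed matrix\<close>

text \<open>\<open>M\<close> maps the range of \<open>S1\<close> into itself; the coordinates of the
  image are found by testing against \<open>S1 *v e\<close>, as \<open>S1\<close> preserves inner
  products.\<close>

lemma compression_intertwines:
  assumes orth: "transpose S1 ** S1 = mat 1" and span: "range (\<lambda>y. S1 *v y) = N"
  shows "M *v (S1 *v x) = S1 *v ((transpose S1 ** A ** S1) *v x)"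
proof -
  have S1_in: "S1 *v y \<in> N" for y using span by blast
  have left_inv: "transpose S1 *v (S1 *v y) = y" for y
    by (simp add: matrix_vector_mul_assoc orth del: transpose_matrix_vector)
  have "M *v (S1 *v x) \<in> N" using M_image S1_in by blast
  then obtain y where y: "M *v (S1 *v x) = S1 *v y" using span by blast
  have "y = transpose S1 *v (A *v (S1 *v x))"
  proof (rule vector_eq_rdot[THEN iffD1], intro allI)
    fix e
    have "y \<bullet> e = (S1 *v y) \<bullet> (S1 *v e)"
      by (simp only: inner_matrix_vector_transpose left_inv)
    also have "\<dots> = (S1 *v e) \<bullet> (A *v (S1 *v x))"
      unfolding y[symmetric] M_apply Pr_id[OF S1_in] inner_Pr[OF S1_in] by (rule inner_commute)
    finally show "y \<bullet> e = (transpose S1 *v (A *v (S1 *v x))) \<bullet> e"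
      by (simp only: inner_matrix_vector_transpose inner_commute)
  qed
  then show ?thesis
    using y by (simp add: matrix_vector_mul_assoc matrix_mul_assoc del: transpose_matrix_vector)
qed

text \<open>\<open>S1\<close> is a bijection onto \<open>N\<close> that conjugates the compressed
  matrix with \<open>M\<close> on \<open>N\<close>.\<close>

lemma compression_eigenvalues:
  assumes orth: "transpose S1 ** S1 = mat 1" and span: "range (\<lambda>y. S1 *v y) = N"
  shows "{t. is_eigenvalue (transpose S1 ** A ** S1) t} = {t. \<exists>z\<in>N. z \<noteq> 0 \<and> M *v z = t *\<^sub>R z}"
proof -
  note intertwine = compression_intertwines[OF orth span]
  have left_inv: "transpose S1 *v (S1 *v y) = y" for y
    by (simp add: matrix_vector_mul_assoc orth del: transpose_matrix_vector)
  have inj: "S1 *v x = S1 *v y \<longleftrightarrow> x = y" for x y using left_inv by metis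
  have "is_eigenvalue (transpose S1 ** A ** S1) t \<longleftrightarrow>
      (\<exists>x. S1 *v x \<noteq> 0 \<and> M *v (S1 *v x) = t *\<^sub>R (S1 *v x))" for t
    unfolding is_eigenvalue_def intertwine
    using inj[of _ 0] inj by (simp flip: matrix_vector_mult_scaleR)
  moreover have "(\<exists>z\<in>N. Q z) \<longleftrightarrow> (\<exists>x. Q (S1 *v x))" for Q
    unfolding span[symmetric] by simp
  ultimately show ?thesis by simp
qed

end

section \<open>Assembly of monotonicity and the error bounds\<close>

theorem theorem4p2:
  fixes A :: "real^'n^'n" and C :: "real^'m^'n" and b :: "real^'m"
    and S1 :: "real^'k^'n"
    and vstar ustar :: "real^'n" and lamstar :: real
    and mu :: "nat \<Rightarrow> real" and x :: "nat \<Rightarrow> nat \<Rightarrow> real"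
    and thmin thmax :: real
  assumes symA: "transpose A = A"
    and mn: "CARD('m) < CARD('n)"
    and rankC: "rank C = CARD('m)"
    and n0_small: "norm (n0 C b) < 1"
    and b0_nz: "b0 A C b \<noteq> 0"
    and dimk: "CARD('k) = CARD('n) - CARD('m)"
    and S1_orth: "transpose S1 ** S1 = mat 1"
    and S1_span: "range (\<lambda>y. S1 *v y) = {z. transpose C *v z = 0}"
    and easy: "QEP_easy_case A C b"
    and vstar_min: "CRQ_minimizer A C b vstar"
    and LG_min: "LG_minimizer A C b lamstar ustar"
    and thmin_def: "thmin = Min {t. is_eigenvalue (transpose S1 ** A ** S1) t}"
    and thmax_def: "thmax = Max {t. is_eigenvalue (transpose S1 ** A ** S1) t}"
    and rLG_min: "\<And>k. 1 \<le> k \<Longrightarrow> k \<le> kmax (Pr C ** A ** Pr C) (b0 A C b) \<Longrightarrow>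
                    rLG_minimizer A C b k (mu k) (x k)"
  shows
   "(let H = transpose S1 ** A ** S1;
         \<gamma> = gam C b;
         kM = kmax (Pr C ** A ** Pr C) (b0 A C b);
         \<kappa> = (thmax - lamstar) / (thmin - lamstar);
         \<Gamma> = (sqrt \<kappa> + 1) / (sqrt \<kappa> - 1);
         nH = onorm (\<lambda>y. (H - mat lamstar) *v y);
         cheb = (\<lambda>k::nat. inverse (\<Gamma> ^ k + inverse \<Gamma> ^ k));
         v = (\<lambda>k. vk A C b k (x k))
     in (\<forall>k. 1 \<le> k \<and> k < kM \<longrightarrow> hq A (v (Suc k)) \<le> hq A (v k)) \<and>
        (\<forall>k. 1 \<le> k \<and> k \<le> kM \<longrightarrow>
           0 \<le> hq A (v k) - hq A vstar \<and>
           hq A (v k) - hq A vstar \<le> 16 * \<gamma>\<^sup>2 * nH * (cheb k)\<^sup>2 \<and>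
           norm (v k - vstar) \<le> 4 * \<gamma> * sqrt \<kappa> * cheb k \<and>
           \<bar>mu k - lamstar\<bar> \<le> 16 * nH * (cheb k)\<^sup>2
              + 4 / \<gamma> * norm (b0 A C b) * sqrt \<kappa> * cheb k))"
proof -
  interpret crq_problem A C b
    using symA rankC n0_small b0_nz by unfold_locales
  define kM where "kM = kmax M g"
  define q where "q j = lq M g (Suc j)" for j
  define u where "u k = (\<Sum>j<k. x k j *\<^sub>R q j)" for k
  define H where "H = transpose S1 ** A ** S1"
  define nH where "nH = onorm (\<lambda>y. (H - mat lamstar) *v y)"
  define E where "E = {t. \<exists>z\<in>N. z \<noteq> 0 \<and> M *v z = t *\<^sub>R z}"
  have span: "range (\<lambda>y. S1 *v y) = N" using S1_span by (simp only: null_space_def)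
  have E: "{t. is_eigenvalue H t} = E"
    unfolding E_def H_def by (rule compression_eigenvalues[OF S1_orth span])
  have "N \<noteq> {0}" using g_in_null_space b0_nz by blast
  note ray = M.eigenvalues_rayleigh[OF subspace_null_space M_image this, folded E_def]
  have th: "thmin = Min E" "thmax = Max E"
    using thmin_def thmax_def unfolding H_def[symmetric] E by auto
  have lo: "thmin * (y \<bullet> y) \<le> y \<bullet> (M *v y)" and hi: "y \<bullet> (M *v y) \<le> thmax * (y \<bullet> y)" if "y \<in> N" for y
    using ray(3,4)[OF that] by (simp_all only: th)
  have "thmin \<in> E" using ray(1,2) by (simp add: th)
  then obtain z where "z \<in> N" "z \<noteq> 0" "M *v z = thmin *\<^sub>R z" unfolding E_def by blast
  \<comment> \<open>The easy case enters here: it makes the gap \<open>thmin - lamstar\<close>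
    strictly positive.\<close>
  from easy_case_multiplier_less[OF easy LG_min lo this]
  have lam: "lamstar < thmin" .
  have th_le: "thmin \<le> thmax" using ray(1,2) by (simp add: th)
  have crit: "sphere_critical ((*v) M) g N \<gamma> lamstar ustar"
    using LG_min by (simp add: LG_minimizer_iff min_critical_def)
  then have uN: "ustar \<in> N" by (simp add: sphere_critical_def)
  have vstar: "vstar = n0 C b + ustar"
    by (rule CRQ_minimizer_eq[OF vstar_min LG_min lam lo])
  have vk: "vk A C b k (x k) = n0 C b + u k" for k
    by (simp add: vk_def u_def q_def)
  have KN: "krylov M g k \<subseteq> N" for k
    by (rule krylov_subset_invariant[OF subspace_null_space M_image g_in_null_space])
  have min: "min_critical ((*v) M) g (krylov M g k) \<gamma> (mu k) (u k)" if "1 \<le> k" "k \<le> kM" for k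
    unfolding u_def q_def using that rLG_min[OF that[unfolded kM_def]]
    by (intro rLG_minimizer_min_critical M_self_adjoint b0_nz) (simp_all add: kM_def)
  then have uk: "u k \<in> krylov M g k" "norm (u k) = \<gamma>" if "1 \<le> k" "k \<le> kM" for k
    using that by (auto simp: min_critical_def sphere_critical_def)
  \<comment> \<open>An eigenvector for \<open>thmax\<close> is a witness for the operator
    norm.\<close>
  have nH: "thmax - lamstar \<le> nH"
  proof -
    have "thmax \<in> E" using ray(1,2) by (simp add: th)
    then have "is_eigenvalue H thmax" using E by blast
    then obtain y where y: "y \<noteq> 0" "H *v y = thmax *\<^sub>R y" by (auto simp: is_eigenvalue_def)
    have "(H - mat lamstar) *v y = (thmax - lamstar) *\<^sub>R y"
      using y by (simp add: matrix_vector_mult_diff_rdistrib mat_mult_vector scaleR_diff_left)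
    then have "\<bar>thmax - lamstar\<bar> * norm y \<le> nH * norm y"
      using onorm[of "\<lambda>y. (H - mat lamstar) *v y" y] by (simp add: nH_def)
    then show ?thesis using y by simp
  qed
  have mono: "hq A (vk A C b (Suc k) (x (Suc k))) \<le> hq A (vk A C b k (x k))"
    if "1 \<le> k" "k < kM" for k
  proof -
    \<comment> \<open>By nesting, the old iterate competes on the sphere of the larger Krylov
      space.\<close>
    have "u k \<in> krylov M g (Suc k)" "norm (u k) = \<gamma>"
      using uk[of k] that krylov_mono_Suc by auto
    then have "quad_obj ((*v) M) g (u (Suc k)) \<le> quad_obj ((*v) M) g (u k)"
      using min[of "Suc k"] that gam_pos
      by (intro M.min_critical_minimizes[OF subspace_krylov]) auto
    moreover have "u k \<in> N" "u (Suc k) \<in> N"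
      using uk(1)[of k] uk(1)[of "Suc k"] that KN by auto
    ultimately show ?thesis by (simp add: vk hq_n0_add)
  qed
  define \<kappa> where "\<kappa> = (thmax - lamstar) / (thmin - lamstar)"
  have err: "0 \<le> hq A (vk A C b k (x k)) - hq A vstar"
    "hq A (vk A C b k (x k)) - hq A vstar \<le> 16 * \<gamma>\<^sup>2 * nH * (cheb_factor \<kappa> k)\<^sup>2"
    "norm (vk A C b k (x k) - vstar) \<le> 4 * \<gamma> * sqrt \<kappa> * cheb_factor \<kappa> k"
    "\<bar>mu k - lamstar\<bar> \<le> 16 * nH * (cheb_factor \<kappa> k)\<^sup>2
      + 4 / \<gamma> * norm g * sqrt \<kappa> * cheb_factor \<kappa> k"
    if k: "1 \<le> k" "k \<le> kM" for k
  proof -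
    \<comment> \<open>The abstract bound takes \<alpha> and \<beta> relative to the multiplier, so
      they become the gaps \<open>thmin - lamstar\<close> and \<open>thmax - lamstar\<close>, with
      quotient \<kappa>.\<close>
    have lo': "(lamstar + (thmin - lamstar)) * (y \<bullet> y) \<le> y \<bullet> (M *v y)"
      and hi': "y \<bullet> (M *v y) \<le> (lamstar + (thmax - lamstar)) * (y \<bullet> y)" if "y \<in> N" for y
      using lo[OF that] hi[OF that] by simp_all
    have \<alpha>: "0 < thmin - lamstar" "thmin - lamstar \<le> thmax - lamstar"
      using lam th_le by simp_all
    note krylov_err = M.min_critical_krylov_error[OF subspace_null_space M_image gam_pos
        g_in_null_space crit lo' hi' \<alpha> subspace_krylov krylov_mono_Suc krylov_image KN
        start_in_krylov k(1) min[OF k], folded \<kappa>_def]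
    have obj: "hq A (vk A C b k (x k)) - hq A vstar
        = quad_obj ((*v) M) g (u k) - quad_obj ((*v) M) g ustar"
    proof -
      have "u k \<in> N" using uk(1)[OF k] KN by blast
      then show ?thesis using uN by (simp add: vk vstar hq_n0_add)
    qed
    show "0 \<le> hq A (vk A C b k (x k)) - hq A vstar"
      unfolding obj by (rule krylov_err(1))
    have "16 * \<gamma>\<^sup>2 * (thmax - lamstar) * (cheb_factor \<kappa> k)\<^sup>2
        \<le> 16 * \<gamma>\<^sup>2 * nH * (cheb_factor \<kappa> k)\<^sup>2"
      using nH by (intro mult_right_mono mult_left_mono) auto
    with krylov_err(2)
    show "hq A (vk A C b k (x k)) - hq A vstar \<le> 16 * \<gamma>\<^sup>2 * nH * (cheb_factor \<kappa> k)\<^sup>2"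
      unfolding obj by (rule order_trans)
    show "norm (vk A C b k (x k) - vstar) \<le> 4 * \<gamma> * sqrt \<kappa> * cheb_factor \<kappa> k"
      using krylov_err(3) by (simp add: vk vstar)
    have "16 * (thmax - lamstar) * (cheb_factor \<kappa> k)\<^sup>2 \<le> 16 * nH * (cheb_factor \<kappa> k)\<^sup>2"
      using nH by (intro mult_right_mono mult_left_mono) auto
    with krylov_err(4)
    show "\<bar>mu k - lamstar\<bar> \<le> 16 * nH * (cheb_factor \<kappa> k)\<^sup>2
        + 4 / \<gamma> * norm g * sqrt \<kappa> * cheb_factor \<kappa> k"
      by linarith
  qed
  show ?thesis
    using mono err
    by (simp only: Let_def H_def[symmetric] nH_def[symmetric] kM_def[symmetric] \<kappa>_def[symmetric]
        cheb_factor_def[unfolded Let_def, symmetric] simp_thms) blast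
qed

end
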